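(* Let $n\ge1$, $N=2^n$, and let $(\omega,\gamma)$ be a good 6-round affine key-schedule (as defined in the context). Consider the 6-round cipher $\mathsf{KAFw}^{P,(\omega,\gamma)}$ built on a uniformly random permutation $P$ of $\{0,1\}^n$. Then for all non-negative integers $q_f,q_e$ with $q_f+4q_e\le N/2$, $$\mathbf{Adv}^{\oplus\text{-rka}}_{\mathsf{KAFw}^{P,(\omega,\gamma)}}(q_f,q_e)\le\frac{14q_eq_f+57q_e^2+4q_e}{N}.$$
   Context: Identify $\{0,1\}^n$ with $\mathbb{F}_2^n$; $X\|Y$ denotes concatenation. A 6-round affine key-schedule $(\omega,\gamma)$ is given by $n\times n$ matrices $M^{(w)}_0,\dots,M^{(w)}_3,M_1,\dots,M_6$ over $\mathbb{F}_2$ and constants $C^{(w)}_i,C_j\in\mathbb{F}_2^n$ with $\omega_i(k)=M^{(w)}_i\cdot k\oplus C^{(w)}_i$ ($i=0,\dots,3$), $\gamma_j(k)=M_j\cdot k\oplus C_j$ ($j=1,\dots,6$). It is good if (1) $\varphi_1=\omega_1\oplus\gamma_1$, $\varphi_6=\omega_2\oplus\gamma_6$ and $\varphi_1\oplus\varphi_6$ are bijections of $\{0,1\}^n$, and (2) for every $\Delta\ne0$, $M_1\cdot\Delta\ne M_3\cdot\Delta$ and $M_4\cdot\Delta\ne M_6\cdot\Delta$. For $f:\{0,1\}^n\to\{0,1\}^n$ and $\kappa$ let $\Psi^f_\kappa(W_L\|W_R)=W_R\|(W_L\oplus f(\kappa\oplus W_R))$; the cipher is $\mathsf{KAFw}^{f,(\omega,\gamma)}_k(W)=(\omega_2(k)\|\omega_3(k))\oplus\Psi^f_{\gamma_6(k)}\circ\cdots\circ\Psi^f_{\gamma_1(k)}\big((\omega_0(k)\|\omega_1(k))\oplus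 W\big)$ (same $f$ in every round). Related-key security: $\mathsf{RK}[E_k]$ maps $(\Delta,LR)\mapsto E_{k\oplus\Delta}(LR)$, inverse $(\Delta,ST)\mapsto E^{-1}_{k\oplus\Delta}(ST)$. A computationally unbounded distinguisher has two-sided access to the related-key oracle and two-sided access to $P$. Real world: $k$ uniform, $P$ uniform random permutation, oracles $(\mathsf{RK}[\mathsf{KAFw}^{P,(\omega,\gamma)}_k],P)$; ideal world: $(\mathsf{RK}[\mathsf{IC}_k],P)$, $\mathsf{IC}$ a uniformly random blockcipher ($2n$-bit blocks, $n$-bit keys) independent of $P$, $k$ uniform. $\mathbf{Adv}^{\oplus\text{-rka}}(q_f,q_e)$ is the maximum over distinguishers making $q_f$ queries to $P$ and $q_e$ related-key queries of the absolute difference of the probabilities of outputting 1 in the two worlds. *)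

theory Defs
  imports "HOL-Probability.Probability_Mass_Function" "HOL-Combinatorics.Permutations"
begin

definition bits :: "nat \<Rightarrow> bool list set" where
  "bits n = {x. length x = n}"

definition xorb :: "bool list \<Rightarrow> bool list \<Rightarrow> bool list" where
  "xorb xs ys = map2 (\<noteq>) xs ys"

definition zeros :: "nat \<Rightarrow> bool list" where
  "zeros n = replicate n False"

text \<open>An n x n matrix over F_2 is a function of (row, column) indices (only indices < n matter).
  Matrix-vector product over F_2: (M k)_i = XOR over j<n of (M_ij AND k_j).\<close>

type_synonym f2mat = "nat \<Rightarrow> nat \<Rightarrow> bool"

definition mv :: "nat \<Rightarrow> f2mat \<Rightarrow> bool list \<Rightarrow> bool list" where
  "mv n M k = map (\<lambda>i. odd (card {j. j < n \<and> M i j \<and> k ! j})) [0..<n]"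

text \<open>Mw i, Cw i for i = 0..3 (the omega's); Mg j, Cg j for j = 1..6 (the gamma's).\<close>

record sched =
  Mw :: "nat \<Rightarrow> f2mat"
  Cw :: "nat \<Rightarrow> bool list"
  Mg :: "nat \<Rightarrow> f2mat"
  Cg :: "nat \<Rightarrow> bool list"

definition affine_sched :: "nat \<Rightarrow> sched \<Rightarrow> bool" where
  "affine_sched n S \<longleftrightarrow> (\<forall>i<4. length (Cw S i) = n) \<and> (\<forall>j\<in>{1..6}. length (Cg S j) = n)"

definition omg :: "nat \<Rightarrow> sched \<Rightarrow> nat \<Rightarrow> bool list \<Rightarrow> bool list" where
  "omg n S i k = xorb (mv n (Mw S i) k) (Cw S i)"

definition gam :: "nat \<Rightarrow> sched \<Rightarrow> nat \<Rightarrow> bool list \<Rightarrow> bool list" where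
  "gam n S j k = xorb (mv n (Mg S j) k) (Cg S j)"

definition good_sched :: "nat \<Rightarrow> sched \<Rightarrow> bool" where
  "good_sched n S \<longleftrightarrow>
     (let phi1 = (\<lambda>k. xorb (omg n S 1 k) (gam n S 1 k));
          phi6 = (\<lambda>k. xorb (omg n S 2 k) (gam n S 6 k))
      in bij_betw phi1 (bits n) (bits n) \<and> bij_betw phi6 (bits n) (bits n)
         \<and> bij_betw (\<lambda>k. xorb (phi1 k) (phi6 k)) (bits n) (bits n))
   \<and> (\<forall>d\<in>bits n. d \<noteq> zeros n \<longrightarrow>
         mv n (Mg S 1) d \<noteq> mv n (Mg S 3) d \<and> mv n (Mg S 4) d \<noteq> mv n (Mg S 6) d)"

definition Psi :: "(bool list \<Rightarrow> bool list) \<Rightarrow> bool list \<Rightarrow> bool list \<times> bool list \<Rightarrow> bool list \<times> bool list" where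
  "Psi f kap W = (snd W, xorb (fst W) (f (xorb kap (snd W))))"

definition KAFw :: "nat \<Rightarrow> sched \<Rightarrow> (bool list \<Rightarrow> bool list) \<Rightarrow> bool list \<Rightarrow> bool list \<Rightarrow> bool list" where
  "KAFw n S f k W =
     (let X = (xorb (omg n S 0 k) (take n W), xorb (omg n S 1 k) (drop n W));
          Y = fold (\<lambda>j Z. Psi f (gam n S j k) Z) [1..<7] X
      in xorb (omg n S 2 k) (fst Y) @ xorb (omg n S 3 k) (snd Y))"

datatype query =
    PFwd "bool list"
  | PInv "bool list"
  | EFwd "bool list" "bool list"      \<comment> \<open>RK[E_k](Delta, LR) = E_{k xor Delta}(LR)\<close>
  | EInv "bool list" "bool list"      \<comment> \<open>RK[E_k]^{-1}(Delta, ST) = E_{k xor Delta}^{-1}(ST)\<close>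

datatype dist =
    Out bool
  | Coin "bool \<Rightarrow> dist"
  | Ask query "bool list \<Rightarrow> dist"

primrec is_Pquery :: "query \<Rightarrow> bool" where
  "is_Pquery (PFwd x) = True"
| "is_Pquery (PInv y) = True"
| "is_Pquery (EFwd d w) = False"
| "is_Pquery (EInv d w) = False"

primrec query_bounded :: "dist \<Rightarrow> nat \<Rightarrow> nat \<Rightarrow> bool" where
  "query_bounded (Out b) qf qe = True"
| "query_bounded (Coin g) qf qe = (\<forall>c. query_bounded (g c) qf qe)"
| "query_bounded (Ask q g) qf qe =
     (if is_Pquery q then 0 < qf \<and> (\<forall>r. query_bounded (g r) (qf - 1) qe)
      else 0 < qe \<and> (\<forall>r. query_bounded (g r) qf (qe - 1)))"

primrec run :: "(query \<Rightarrow> bool list) \<Rightarrow> dist \<Rightarrow> bool pmf" where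
  "run orc (Out b) = return_pmf b"
| "run orc (Coin g) = bernoulli_pmf (1/2) \<bind> (\<lambda>c. run orc (g c))"
| "run orc (Ask q g) = run orc (g (orc q))"

text \<open>Function answering P and RK queries, given P and the family of keyed block permutations.
  Malformed queries (wrong lengths) get the fixed answer [] in both worlds.\<close>

definition answer :: "nat \<Rightarrow> (bool list \<Rightarrow> bool list) \<Rightarrow> (bool list \<Rightarrow> bool list \<Rightarrow> bool list)
                      \<Rightarrow> bool list \<Rightarrow> query \<Rightarrow> bool list" where
  "answer n P E k q = (case q of
      PFwd x \<Rightarrow> if x \<in> bits n then P x else []
    | PInv y \<Rightarrow> if y \<in> bits n then inv_into (bits n) P y else []
    | EFwd d w \<Rightarrow> if d \<in> bits n \<and> w \<in> bits (2*n) then E (xorb k d) w else []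
    | EInv d s \<Rightarrow> if d \<in> bits n \<and> s \<in> bits (2*n) then inv_into (bits (2*n)) (E (xorb k d)) s else [])"

definition perms :: "nat \<Rightarrow> (bool list \<Rightarrow> bool list) set" where
  "perms n = {p. p permutes bits n}"

definition blockciphers :: "nat \<Rightarrow> (bool list \<Rightarrow> bool list \<Rightarrow> bool list) set" where
  "blockciphers n = {E. (\<forall>k\<in>bits n. E k permutes bits (2*n)) \<and> (\<forall>k. k \<notin> bits n \<longrightarrow> E k = id)}"

definition real_world :: "nat \<Rightarrow> sched \<Rightarrow> dist \<Rightarrow> bool pmf" where
  "real_world n S D =
     do { k \<leftarrow> pmf_of_set (bits n); P \<leftarrow> pmf_of_set (perms n);
          run (answer n P (KAFw n S P) k) D }"

definition ideal_world :: "nat \<Rightarrow> dist \<Rightarrow> bool pmf" where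
  "ideal_world n D =
     do { k \<leftarrow> pmf_of_set (bits n); P \<leftarrow> pmf_of_set (perms n);
          IC \<leftarrow> pmf_of_set (blockciphers n);
          run (answer n P IC k) D }"

definition rka_adv :: "nat \<Rightarrow> sched \<Rightarrow> dist \<Rightarrow> real" where
  "rka_adv n S D = \<bar>pmf (real_world n S D) True - pmf (ideal_world n D) True\<bar>"

end

theory Submission
  imports Defs
begin

text \<open>This is an H-coefficient argument in which the key is averaged over instead of being revealed:
  in the ideal world the transcript is independent of the key, so it suffices that, for every transcript
  without a two-sided collision (two cipher queries agreeing in the inputs of both round 1 and round 6),
  the key-averaged real weight is at least 1 - \<open>\<epsilon>\<close> times the ideal weight. A two-sided collision arises with
  a fresh answer of the random cipher with probability \<open>O(q\<^sub>e / N)\<close>.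

  For the ratio, fix a key for which the inputs of rounds 1 and 6 avoid the known points of P and each
  other; this fails for few keys because \<open>\<phi>\<^sub>1\<close>, \<open>\<phi>\<^sub>6\<close> and their sum are injective. Expose P first at the
  inputs of rounds 1 and 6, then at the inputs of rounds 2 and 5. Up to small probability the inputs of
  rounds 3 and 4 are then distinct fresh points, and the values P must take there for the cipher to meet
  in the middle are distinct and fresh too, so these 2q equations hold with probability at least \<open>N\<^sup>-\<^sup>2\<^sup>q\<close>.
  Condition (2) on the schedule separates the round 3 (and round 4) inputs of two queries that agree in
  the two rounds before.\<close>

subsection \<open>Bit strings\<close>

text \<open>The obstacle is that one P serves all six rounds, so inputs of different rounds must be
  kept apart as well. Cutting every query in the middle yields two ends with formally identical
  equations; one argument over 2u ends, with an involution exchanging the ends of a query, then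
  treats rounds 1-3 and 6-4 together. Two-sided collisions can be judged without the key because the
  schedule is affine: the key shifts all round 1 inputs by one common mask and all round 6 inputs by
  another. Only lower bounds on the real weight are needed, since they apply to both output bits. As
  at most N/4 points of P are known when one is exposed, an unwanted coincidence has probability at
  most 4/(3N). With u cipher and q permutation queries, the two exposures cost 8uq + 48u^2 + 8u/3
  over N, bad keys 2uq + u^2, the missing replacement in the random cipher u^2, and collisions 2u^2,
  in total at most 10uq + 52u^2 + 3u.\<close>

lemma finite_bits [simp]: "finite (bits n)"
  and card_bits: "card (bits n) = 2 ^ n"
  using finite_lists_length_eq[of "UNIV :: bool set" n] card_lists_length_eq[of "UNIV :: bool set" n]
  by (simp_all add: bits_def)

lemma length_xorb [simp]: "length (xorb x y) = min (length x) (length y)"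
  by (simp add: xorb_def)

lemma nth_xorb [simp]: "i < length x \<Longrightarrow> i < length y \<Longrightarrow> xorb x y ! i = (x ! i \<noteq> y ! i)"
  by (simp add: xorb_def)

lemma bits_eqI: "x \<in> bits n \<Longrightarrow> y \<in> bits n \<Longrightarrow> (\<And>i. i < n \<Longrightarrow> x ! i = y ! i) \<Longrightarrow> x = y"
  by (auto simp: bits_def intro: nth_equalityI)

lemma bits_nonempty [simp]: "bits n \<noteq> {}"
  using length_replicate[of n True] by (auto simp: bits_def simp del: length_replicate)

lemma xorb_bits [simp]: "x \<in> bits n \<Longrightarrow> y \<in> bits n \<Longrightarrow> xorb x y \<in> bits n"
  by (simp add: bits_def)

lemma zeros_bits [simp]: "zeros n \<in> bits n"
  by (simp add: bits_def zeros_def)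

lemma xorb_commute: "xorb x y = xorb y x"
  by (rule nth_equalityI) (auto simp: min.commute)

lemma xorb_assoc: "xorb (xorb x y) z = xorb x (xorb y z)"
  by (rule nth_equalityI) auto

lemma xorb_left_commute: "xorb x (xorb y z) = xorb y (xorb x z)"
  by (metis xorb_assoc xorb_commute)

lemmas xorb_ac = xorb_assoc xorb_commute xorb_left_commute

lemma xorb_cancel: "x \<in> bits n \<Longrightarrow> y \<in> bits n \<Longrightarrow> xorb x (xorb x y) = y"
  by (rule bits_eqI[of _ n]) (auto simp: bits_def)

lemma xorb_self: "x \<in> bits n \<Longrightarrow> xorb x x = zeros n"
  by (rule bits_eqI[of _ n]) (auto simp: bits_def zeros_def)

lemma xorb_zeros: "x \<in> bits n \<Longrightarrow> xorb (zeros n) x = x"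
  by (rule bits_eqI[of _ n]) (auto simp: bits_def zeros_def)

lemma xorb_solve: "x \<in> bits n \<Longrightarrow> y \<in> bits n \<Longrightarrow> xorb x y = z \<Longrightarrow> y = xorb x z"
  by (auto simp: xorb_cancel)

lemma xorb_inject: "x \<in> bits n \<Longrightarrow> y \<in> bits n \<Longrightarrow> z \<in> bits n \<Longrightarrow> xorb x y = xorb x z \<longleftrightarrow> y = z"
  using xorb_cancel[of x n y] xorb_cancel[of x n z] by metis

lemma mv_bits [simp]: "mv n M k \<in> bits n"
  by (simp add: mv_def bits_def)

text \<open>An entry of the product is the parity of a set of columns. Adding vectors takes the
  symmetric difference of two such sets, and counting their intersection twice does not change
  parity.\<close>

lemma mv_xorb:
  assumes "k \<in> bits n" "d \<in> bits n"
  shows "mv n M (xorb k d) = xorb (mv n M k) (mv n M d)"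
proof (rule bits_eqI)
  fix i assume i: "i < n"
  let ?A = "{j. j < n \<and> M i j \<and> k ! j}" and ?B = "{j. j < n \<and> M i j \<and> d ! j}"
  have parity: "odd (a + b) = (odd (a + c) \<noteq> odd (b + c))" for a b c :: nat
    by (simp only: odd_add; argo)
  have eq: "{j. j < n \<and> M i j \<and> xorb k d ! j} = (?A - ?B) \<union> (?B - ?A)"
    using assms by (auto simp: bits_def)
  have AB: "card ((?A - ?B) \<union> (?B - ?A)) = card (?A - ?B) + card (?B - ?A)"
    by (rule card_Un_disjoint) auto
  have A: "card (?A - ?B) + card (?A \<inter> ?B) = card ?A"
    by (subst card_Un_disjoint[symmetric]) (auto intro: arg_cong[where f=card])
  have B: "card (?B - ?A) + card (?A \<inter> ?B) = card ?B"
    by (subst card_Un_disjoint[symmetric]) (auto intro: arg_cong[where f=card])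
  have "odd (card {j. j < n \<and> M i j \<and> xorb k d ! j}) = (odd (card ?A) \<noteq> odd (card ?B))"
    unfolding eq AB A[symmetric] B[symmetric] by (rule parity)
  then show "mv n M (xorb k d) ! i = xorb (mv n M k) (mv n M d) ! i"
    using i by (simp add: mv_def)
qed (use assms in auto)

subsection \<open>Permutations extending a partial one\<close>

text \<open>The permutations still possible once P is known on the table \<open>Q\<close>. Tables
  come from arbitrary transcripts, so \<open>Q\<close> may be inconsistent and the set
  empty.\<close>

definition Ext :: "nat \<Rightarrow> (bool list \<times> bool list) set \<Rightarrow> (bool list \<Rightarrow> bool list) set" where
  "Ext n Q = {P. P permutes bits n \<and> (\<forall>(x, y)\<in>Q. P x = y)}"

lemma finite_Ext [simp]: "finite (Ext n Q)"
  by (rule finite_subset[OF _ finite_permutations[of "bits n"]]) (auto simp: Ext_def)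

lemma Ext_insert: "Ext n (insert (x, y) Q) = {P \<in> Ext n Q. P x = y}"
  by (auto simp: Ext_def)

lemma Ext_bits: "P \<in> Ext n Q \<Longrightarrow> x \<in> bits n \<Longrightarrow> P x \<in> bits n"
  by (simp add: Ext_def permutes_in_image)

lemma Ext_inj: "P \<in> Ext n Q \<Longrightarrow> P x = P y \<Longrightarrow> x = y"
  by (auto simp: Ext_def dest: permutes_inj injD)

text \<open>Composing with the transposition of \<open>y\<close> and \<open>y'\<close> redirects
  \<open>x\<close> to \<open>y\<close> and moves no recorded output. Freshness is asked of
  \<open>y\<close> only, so a fresh value is at least as likely as any value whatsoever.\<close>

lemma Ext_swap:
  assumes "x \<notin> fst ` Q" "y \<notin> snd ` Q" "y \<in> bits n" "y' \<in> bits n"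
  shows "card (Ext n (insert (x, y') Q)) \<le> card (Ext n (insert (x, y) Q))"
proof (rule card_inj_on_le)
  show "(\<lambda>P. Transposition.transpose y y' \<circ> P) ` Ext n (insert (x, y') Q) \<subseteq> Ext n (insert (x, y) Q)"
  proof
    fix P' assume "P' \<in> (\<lambda>P. Transposition.transpose y y' \<circ> P) ` Ext n (insert (x, y') Q)"
    then obtain P where P: "P \<in> Ext n Q" "P x = y'" "P' = Transposition.transpose y y' \<circ> P"
      by (auto simp: Ext_insert)
    have "P' permutes bits n"
      unfolding P(3) using P(1) assms by (intro permutes_compose permutes_swap_id) (auto simp: Ext_def)
    moreover have "P' a = b" if "(a, b) \<in> Q" for a b
    proof -
      have "P a = b" using P that by (auto simp: Ext_def)
      moreover have "b \<noteq> y" using assms(2) that by force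
      moreover have "a \<noteq> x" using assms(1) that by force
      ultimately show ?thesis using Ext_inj[OF P(1), of a x] P(2,3) by (auto simp: Transposition.transpose_def)
    qed
    ultimately show "P' \<in> Ext n (insert (x, y) Q)" using P by (auto simp: Ext_def)
  qed
  show "inj_on (\<lambda>P. Transposition.transpose y y' \<circ> P) (Ext n (insert (x, y') Q))"
    by (rule inj_onI) (metis comp_assoc transpose_comp_involutory id_comp)
qed simp

lemma card_partition_bounded:
  assumes "finite A" "finite B" "f ` A \<subseteq> B"
  shows "card A = (\<Sum>b\<in>B. card {a \<in> A. f a = b})"
  using sum.group[OF assms, of "\<lambda>_. 1 :: nat"] by simp

lemma Ext_fresh_lower:
  assumes "x \<in> bits n" "x \<notin> fst ` Q" "y \<notin> snd ` Q" "y \<in> bits n"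
  shows "card (Ext n Q) \<le> 2 ^ n * card (Ext n (insert (x, y) Q))"
proof -
  have "card (Ext n Q) = (\<Sum>y'\<in>bits n. card {P \<in> Ext n Q. P x = y'})"
    by (rule card_partition_bounded) (auto intro: Ext_bits assms)
  also have "\<dots> \<le> (\<Sum>y'\<in>bits n. card (Ext n (insert (x, y) Q)))"
    using Ext_swap[OF assms(2-4)] by (intro sum_mono) (auto simp: Ext_insert)
  finally show ?thesis by (simp add: card_bits)
qed

text \<open>A value that is recorded or no bit string of length \<open>n\<close> is never taken at
  the unrecorded point \<open>x\<close>. The others, at least \<open>2 ^ n - card Q\<close> many,
  are equally likely.\<close>

lemma Ext_fresh_upper:
  assumes "x \<in> bits n" "x \<notin> fst ` Q" "finite Q"
  shows "(2 ^ n - card Q) * card {P \<in> Ext n Q. P x = v} \<le> card (Ext n Q)"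
proof (cases "v \<in> bits n \<and> v \<notin> snd ` Q")
  case False
  have "P x \<noteq> v" if P: "P \<in> Ext n Q" for P
  proof
    assume v: "P x = v"
    then obtain a where "(a, v) \<in> Q"
      using False Ext_bits[OF P assms(1)] by auto
    then have "P a = P x" "a \<in> fst ` Q" using P v by (force simp: Ext_def)+
    then show False using Ext_inj[OF P, of a x] assms(2) by auto
  qed
  then have none: "{P \<in> Ext n Q. P x = v} = {}" by blast
  show ?thesis unfolding none by simp
next
  case True
  have "(2 ^ n - card Q) \<le> card (bits n - snd ` Q)"
    using diff_card_le_card_Diff[of "snd ` Q" "bits n"] card_image_le[OF assms(3), of snd]
    by (simp add: card_bits assms)
  then have "(2 ^ n - card Q) * card {P \<in> Ext n Q. P x = v} \<le>
      (\<Sum>y'\<in>bits n - snd ` Q. card {P \<in> Ext n Q. P x = v})" by simp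
  also have "\<dots> \<le> (\<Sum>y'\<in>bits n - snd ` Q. card {P \<in> Ext n Q. P x = y'})"
    using Ext_swap[OF assms(2), of _ n v] True by (intro sum_mono) (auto simp: Ext_insert)
  also have "\<dots> \<le> (\<Sum>y'\<in>bits n. card {P \<in> Ext n Q. P x = y'})"
    by (rule sum_mono2) auto
  also have "\<dots> = card (Ext n Q)"
    by (rule card_partition_bounded[symmetric]) (auto intro: Ext_bits assms)
  finally show ?thesis .
qed

subsection \<open>Rare events\<close>

text \<open>A probability bound with the denominator multiplied out, so that it remains meaningful
  when \<open>Ext n Q\<close> is empty.\<close>

definition rare :: "'w set \<Rightarrow> ('w \<Rightarrow> bool) \<Rightarrow> real \<Rightarrow> bool" where
  "rare \<Omega> E \<beta> \<longleftrightarrow> real (card {\<omega> \<in> \<Omega>. E \<omega>}) \<le> \<beta> * real (card \<Omega>)"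

lemma rare_mono:
  assumes "rare \<Omega> E \<beta>" "finite \<Omega>" "\<And>\<omega>. \<omega> \<in> \<Omega> \<Longrightarrow> E' \<omega> \<Longrightarrow> E \<omega>" "\<beta> \<le> \<beta>'"
  shows "rare \<Omega> E' \<beta>'"
proof -
  have "card {\<omega> \<in> \<Omega>. E' \<omega>} \<le> card {\<omega> \<in> \<Omega>. E \<omega>}"
    using assms by (intro card_mono) auto
  moreover have "\<beta> * real (card \<Omega>) \<le> \<beta>' * real (card \<Omega>)"
    using assms by (intro mult_right_mono) auto
  ultimately show ?thesis using assms(1) by (simp add: rare_def)
qed

lemma rare_impossible: "0 \<le> \<beta> \<Longrightarrow> (\<And>\<omega>. \<omega> \<in> \<Omega> \<Longrightarrow> \<not> E \<omega>) \<Longrightarrow> rare \<Omega> E \<beta>"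
proof -
  assume "0 \<le> \<beta>" and none: "\<And>\<omega>. \<omega> \<in> \<Omega> \<Longrightarrow> \<not> E \<omega>"
  have "{\<omega> \<in> \<Omega>. E \<omega>} = {}" using none by blast
  show ?thesis using \<open>0 \<le> \<beta>\<close> unfolding rare_def \<open>{\<omega> \<in> \<Omega>. E \<omega>} = {}\<close> by simp
qed

lemma rare_disj:
  assumes "rare \<Omega> E \<beta>" "rare \<Omega> E' \<beta>'"
  shows "rare \<Omega> (\<lambda>\<omega>. E \<omega> \<or> E' \<omega>) (\<beta> + \<beta>')"
proof -
  have "{\<omega> \<in> \<Omega>. E \<omega> \<or> E' \<omega>} = {\<omega> \<in> \<Omega>. E \<omega>} \<union> {\<omega> \<in> \<Omega>. E' \<omega>}" by blast
  then have "card {\<omega> \<in> \<Omega>. E \<omega> \<or> E' \<omega>} \<le> card {\<omega> \<in> \<Omega>. E \<omega>} + card {\<omega> \<in> \<Omega>. E' \<omega>}"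
    using card_Un_le[of "{\<omega> \<in> \<Omega>. E \<omega>}" "{\<omega> \<in> \<Omega>. E' \<omega>}"] by simp
  then show ?thesis using assms unfolding rare_def distrib_right by linarith
qed

lemma rare_ex:
  fixes \<beta> :: real
  assumes "finite J" "0 \<le> \<beta>" "\<And>j. j \<in> J \<Longrightarrow> rare \<Omega> (E j) \<beta>"
  shows "rare \<Omega> (\<lambda>\<omega>. \<exists>j\<in>J. E j \<omega>) (card J * \<beta>)"
  using assms
proof (induction J rule: finite_induct)
  case empty
  then show ?case by (simp add: rare_def)
next
  case (insert j J)
  have "rare \<Omega> (\<lambda>\<omega>. E j \<omega> \<or> (\<exists>j\<in>J. E j \<omega>)) (\<beta> + card J * \<beta>)"
    using insert by (intro rare_disj) auto
  then show ?case using insert by (simp add: algebra_simps)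
qed

lemma rare_ex2:
  fixes \<beta> :: real
  assumes "finite A" "finite B" "0 \<le> \<beta>" "\<And>a b. a \<in> A \<Longrightarrow> b \<in> B \<Longrightarrow> rare \<Omega> (E a b) \<beta>"
  shows "rare \<Omega> (\<lambda>\<omega>. \<exists>a\<in>A. \<exists>b\<in>B. E a b \<omega>) (card A * card B * \<beta>)"
proof -
  have "rare \<Omega> (\<lambda>\<omega>. \<exists>b\<in>B. E a b \<omega>) (card B * \<beta>)" if "a \<in> A" for a
    using that assms by (intro rare_ex) auto
  then have "rare \<Omega> (\<lambda>\<omega>. \<exists>a\<in>A. \<exists>b\<in>B. E a b \<omega>) (card A * (card B * \<beta>))"
    using assms by (intro rare_ex) auto
  then show ?thesis by (simp add: mult.assoc)
qed

lemma rare_complement: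
  assumes "rare \<Omega> E \<beta>" "finite \<Omega>" "\<And>\<omega>. \<omega> \<in> \<Omega> \<Longrightarrow> \<not> E \<omega> \<Longrightarrow> G \<omega>"
  shows "(1 - \<beta>) * card \<Omega> \<le> card {\<omega> \<in> \<Omega>. G \<omega>}"
proof -
  have "card \<Omega> \<le> card ({\<omega> \<in> \<Omega>. G \<omega>} \<union> {\<omega> \<in> \<Omega>. E \<omega>})"
    using assms by (intro card_mono) auto
  also have "\<dots> \<le> card {\<omega> \<in> \<Omega>. G \<omega>} + card {\<omega> \<in> \<Omega>. E \<omega>}" by (rule card_Un_le)
  finally show ?thesis using assms(1) by (simp add: rare_def algebra_simps)
qed

text \<open>At most a quarter of P is known, so at least 3/4 of the \<open>2 ^ n\<close> values are
  open for \<open>P x\<close>; this is the origin of 4/(3N).\<close>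

lemma Ext_hit:
  assumes "a \<in> bits n" "x \<in> bits n" "x \<notin> fst ` Q" "finite Q" "4 * card Q \<le> 2 ^ n"
  shows "rare (Ext n Q) (\<lambda>P. xorb a (P x) = v) (4 / (3 * 2 ^ n))"
proof -
  have "(2 ^ n - card Q) * card {P \<in> Ext n Q. P x = xorb a v} \<le> card (Ext n Q)"
    by (rule Ext_fresh_upper) (use assms in auto)
  then have "real (2 ^ n - card Q) * real (card {P \<in> Ext n Q. P x = xorb a v}) \<le> real (card (Ext n Q))"
    unfolding of_nat_mult[symmetric] of_nat_le_iff .
  moreover have "real (2 ^ n - card Q) \<ge> 3 / 4 * 2 ^ n"
  proof -
    have "real (4 * card Q) \<le> real (2 ^ n)" "card Q \<le> 2 ^ n"
      using assms(5) by (simp_all only: of_nat_le_iff)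
    then show ?thesis by simp
  qed
  ultimately have "3 / 4 * 2 ^ n * real (card {P \<in> Ext n Q. P x = xorb a v}) \<le> real (card (Ext n Q))"
    using mult_right_mono[of "3 / 4 * 2 ^ n" "real (2 ^ n - card Q)"
        "real (card {P \<in> Ext n Q. P x = xorb a v})"] by linarith
  then have "rare (Ext n Q) (\<lambda>P. P x = xorb a v) (4 / (3 * 2 ^ n))"
    by (simp add: rare_def field_simps)
  then show ?thesis
    by (rule rare_mono) (auto intro: xorb_solve[OF assms(1) Ext_bits[OF _ assms(2)]])
qed

text \<open>Once \<open>P x'\<close> is fixed the right side is a constant and
  \<open>Ext_hit\<close> applies; the fixed pair accounts for the extra point in the size bound. The
  arbitrary \<open>g\<close> absorbs whatever mask stands next to \<open>P x'\<close>.\<close>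

lemma Ext_hit2:
  assumes "a \<in> bits n" "x \<in> bits n" "x' \<in> bits n" "x \<noteq> x'" "x \<notin> fst ` Q" "x' \<notin> fst ` Q"
    and "finite Q" "4 * (card Q + 1) \<le> 2 ^ n"
  shows "rare (Ext n Q) (\<lambda>P. xorb a (P x) = g (P x')) (4 / (3 * 2 ^ n))"
proof -
  let ?\<beta> = "4 / (3 * 2 ^ n) :: real" and ?E = "\<lambda>P. xorb a (P x) = g (P x')"
  have "real (card {P \<in> Ext n Q. ?E P}) =
      (\<Sum>v\<in>bits n. real (card {P \<in> {P \<in> Ext n Q. ?E P}. P x' = v}))"
    by (subst card_partition_bounded[of _ "bits n" "\<lambda>P. P x'"]) (auto intro: Ext_bits assms)
  also have "\<dots> = (\<Sum>v\<in>bits n. real (card {P \<in> Ext n (insert (x', v) Q). xorb a (P x) = g v}))"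
    by (intro sum.cong refl arg_cong[where f="\<lambda>X. real (card X)"]) (auto simp: Ext_insert)
  also have "\<dots> \<le> (\<Sum>v\<in>bits n. ?\<beta> * card (Ext n (insert (x', v) Q)))"
  proof (rule sum_mono)
    fix v
    have "rare (Ext n (insert (x', v) Q)) (\<lambda>P. xorb a (P x) = g v) ?\<beta>"
      by (rule Ext_hit) (use assms in \<open>auto simp: card_insert_if\<close>)
    then show "real (card {P \<in> Ext n (insert (x', v) Q). xorb a (P x) = g v})
        \<le> ?\<beta> * card (Ext n (insert (x', v) Q))" by (simp add: rare_def)
  qed
  also have "\<dots> = ?\<beta> * (\<Sum>v\<in>bits n. real (card {P \<in> Ext n Q. P x' = v}))"
    by (simp add: sum_distrib_left Ext_insert)
  also have "(\<Sum>v\<in>bits n. real (card {P \<in> Ext n Q. P x' = v})) = card (Ext n Q)"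
    by (subst card_partition_bounded[of "Ext n Q" "bits n" "\<lambda>P. P x'"]) (auto intro: Ext_bits assms)
  finally show ?thesis by (simp add: rare_def)
qed

section \<open>Conditioning on the values of P on a set of points\<close>

definition graph_on :: "('a \<Rightarrow> 'b) \<Rightarrow> 'a set \<Rightarrow> ('a \<times> 'b) set" where
  "graph_on P Z = (\<lambda>x. (x, P x)) ` Z"

lemma graph_on_eq_iff: "graph_on P Z = graph_on P' Z \<longleftrightarrow> (\<forall>x\<in>Z. P x = P' x)"
  unfolding graph_on_def by (auto simp: image_iff set_eq_iff)

lemma Ext_graph_on:
  assumes "P \<in> Ext n Q"
  shows "Ext n (Q \<union> graph_on P Z) = {P' \<in> Ext n Q. graph_on P' Z = graph_on P Z}"
proof -
  have "Ext n (Q \<union> graph_on P Z) = {P' \<in> Ext n Q. \<forall>x\<in>Z. P' x = P x}"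
    unfolding Ext_def graph_on_def by (simp add: ball_Un)
  then show ?thesis unfolding graph_on_eq_iff .
qed

lemma Ext_graph_onD: "P' \<in> Ext n (Q \<union> graph_on P Z) \<Longrightarrow> x \<in> Z \<Longrightarrow> P' x = P x"
  by (simp add: Ext_def graph_on_def ball_Un)

text \<open>Total probability over the values on \<open>Z\<close>. \<open>G\<close> marks good
  exposures; inside a class its members are bounded by the whole class, so \<open>G\<close> may also
  look at values outside \<open>Z\<close>, and one representative per class suffices for
  \<open>step\<close>.\<close>

lemma Ext_refine:
  fixes \<beta> :: real
  assumes "0 \<le> \<beta>"
    and step: "\<And>P. P \<in> Ext n Q \<Longrightarrow> G P \<Longrightarrow>
      \<beta> * card (Ext n (Q \<union> graph_on P Z)) \<le> card {P' \<in> Ext n (Q \<union> graph_on P Z). K P'}"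
  shows "\<beta> * card {P \<in> Ext n Q. G P} \<le> card {P \<in> Ext n Q. K P}"
proof -
  let ?f = "\<lambda>P. graph_on P Z"
  let ?T = "?f ` {P \<in> Ext n Q. G P}"
  have "\<beta> * real (card {P \<in> Ext n Q. G P}) = \<beta> * (\<Sum>T\<in>?T. real (card {P \<in> {P \<in> Ext n Q. G P}. ?f P = T}))"
    by (subst card_partition_bounded[of _ ?T ?f]) auto
  also have "\<dots> = (\<Sum>T\<in>?T. \<beta> * real (card {P \<in> {P \<in> Ext n Q. G P}. ?f P = T}))"
    by (rule sum_distrib_left)
  also have "\<dots> \<le> (\<Sum>T\<in>?T. real (card {P \<in> {P \<in> Ext n Q. K P \<and> ?f P \<in> ?T}. ?f P = T}))"
  proof (rule sum_mono)
    fix T assume "T \<in> ?T"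
    then obtain P where P: "P \<in> Ext n Q" "G P" "T = ?f P" by auto
    have "card {P' \<in> {P \<in> Ext n Q. G P}. ?f P' = T} \<le> card (Ext n (Q \<union> graph_on P Z))"
      using P by (intro card_mono) (auto simp: Ext_graph_on)
    then have "\<beta> * real (card {P' \<in> {P \<in> Ext n Q. G P}. ?f P' = T}) \<le> \<beta> * card (Ext n (Q \<union> graph_on P Z))"
      using assms(1) by (intro mult_left_mono) auto
    also have "\<dots> \<le> card {P' \<in> Ext n (Q \<union> graph_on P Z). K P'}" by (rule step) (use P in auto)
    also have "{P' \<in> Ext n (Q \<union> graph_on P Z). K P'} = {P \<in> {P \<in> Ext n Q. K P \<and> ?f P \<in> ?T}. ?f P = T}"
      using P \<open>T \<in> ?T\<close> by (auto simp: Ext_graph_on)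
    finally show "\<beta> * real (card {P' \<in> {P \<in> Ext n Q. G P}. ?f P' = T}) \<le>
      real (card {P \<in> {P \<in> Ext n Q. K P \<and> ?f P \<in> ?T}. ?f P = T})" .
  qed
  also have "\<dots> = real (card {P \<in> Ext n Q. K P \<and> ?f P \<in> ?T})"
    by (subst card_partition_bounded[of _ ?T ?f]) auto
  also have "\<dots> \<le> card {P \<in> Ext n Q. K P}" by (intro of_nat_mono card_mono) auto
  finally show ?thesis .
qed

text \<open>Each equation at a fresh point with a fresh value keeps at least the fraction
  \<open>1 / 2 ^ n\<close>. The equations of rounds 3 and 4 therefore cost no error term beyond
  making their points and values fresh.\<close>

lemma Ext_fresh_family:
  assumes "finite H" "inj_on x H" "inj_on y H"
    and "\<And>h. h \<in> H \<Longrightarrow> x h \<in> bits n" "\<And>h. h \<in> H \<Longrightarrow> y h \<in> bits n"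
    and "\<And>h. h \<in> H \<Longrightarrow> x h \<notin> fst ` Q" "\<And>h. h \<in> H \<Longrightarrow> y h \<notin> snd ` Q"
  shows "card (Ext n Q) \<le> (2 ^ n) ^ card H * card {P \<in> Ext n Q. \<forall>h\<in>H. P (x h) = y h}"
  using assms
proof (induction H arbitrary: Q rule: finite_induct)
  case empty
  then show ?case by simp
next
  case (insert h H)
  let ?Q = "insert (x h, y h) Q"
  have "card (Ext n Q) \<le> 2 ^ n * card (Ext n ?Q)"
    by (rule Ext_fresh_lower) (use insert.prems in auto)
  also have "card (Ext n ?Q) \<le> (2 ^ n) ^ card H * card {P \<in> Ext n ?Q. \<forall>h\<in>H. P (x h) = y h}"
    using insert by (intro insert.IH) (auto simp: image_iff)
  also have "{P \<in> Ext n ?Q. \<forall>h\<in>H. P (x h) = y h} = {P \<in> Ext n Q. \<forall>h\<in>insert h H. P (x h) = y h}"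
    by (auto simp: Ext_insert)
  finally show ?case using insert by (simp add: mult.assoc)
qed

subsection \<open>Exposing the permutation layer by layer\<close>

text \<open>In the application \<open>X\<close> are the inputs of rounds 2 and 5, \<open>A\<close>
  the masks leading on to rounds 3 and 4, \<open>Y\<close> the fixed part of the outputs prescribed
  there, and \<open>st\<close> passes to the other end of the query. The event \<open>B\<close>
  below lists how a new input or a prescribed output can meet a known one or another of its kind.
  With m = \<open>card H\<close> and q = \<open>card Q\<close> these are 2mq + 4m^2
  coincidences.\<close>

lemma second_layer:
  fixes st :: "'h \<Rightarrow> 'h"
  assumes fin: "finite H" "finite Q"
    and st: "\<And>h. h \<in> H \<Longrightarrow> st h \<in> H"
    and bits: "\<And>h. h \<in> H \<Longrightarrow> X h \<in> bits n" "\<And>h. h \<in> H \<Longrightarrow> A h \<in> bits n" "\<And>h. h \<in> H \<Longrightarrow> Y h \<in> bits n"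
    and fresh: "\<And>h. h \<in> H \<Longrightarrow> X h \<notin> fst ` Q"
    and Asep: "\<And>h h'. h \<in> H \<Longrightarrow> h' \<in> H \<Longrightarrow> h \<noteq> h' \<Longrightarrow> X h = X h' \<Longrightarrow> A h \<noteq> A h'"
    and Ynz: "\<And>h. h \<in> H \<Longrightarrow> Y h \<noteq> zeros n"
    and Ysep: "\<And>h h'. h \<in> H \<Longrightarrow> h' \<in> H \<Longrightarrow> h \<noteq> h' \<Longrightarrow> X (st h) = X (st h') \<Longrightarrow> Y h \<noteq> Y h'"
    and small: "4 * (card Q + 1) \<le> 2 ^ n"
  shows "(1 - 4 / (3 * 2 ^ n) * (2 * card H * card Q + 4 * (card H)\<^sup>2)) * card (Ext n Q)
    \<le> (2 ^ n) ^ card H * card {P \<in> Ext n Q. \<forall>h\<in>H. P (xorb (A h) (P (X h))) = xorb (Y h) (P (X (st h)))}"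
proof -
  define c :: real where "c = 4 / (3 * 2 ^ n)"
  have c: "0 \<le> c" by (simp add: c_def)
  define B where "B P \<longleftrightarrow>
    ((\<exists>h\<in>H. \<exists>v\<in>fst ` Q. xorb (A h) (P (X h)) = v) \<or>
     (\<exists>h\<in>H. \<exists>h'\<in>H. xorb (A h) (P (X h)) = X h')) \<or>
    ((\<exists>h\<in>H. \<exists>h'\<in>H. X h \<noteq> X h' \<and> xorb (A h) (P (X h)) = xorb (A h') (P (X h'))) \<or>
     (\<exists>h\<in>H. \<exists>v\<in>snd ` Q. xorb (Y h) (P (X (st h))) = v)) \<or>
    ((\<exists>h\<in>H. \<exists>h'\<in>H. xorb (Y h) (P (X (st h))) = P (X h')) \<or>
     (\<exists>h\<in>H. \<exists>h'\<in>H. X (st h) \<noteq> X (st h') \<and> xorb (Y h) (P (X (st h))) = xorb (Y h') (P (X (st h')))))"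
    for P :: "bool list \<Rightarrow> bool list"
  let ?m = "card H" and ?q = "card Q"
  have hit: "rare (Ext n Q) (\<lambda>P. xorb a (P (X h)) = v) c" if "h \<in> H" "a \<in> bits n" for h a v
    unfolding c_def by (rule Ext_hit) (use that bits fresh fin small in auto)
  have hit2: "rare (Ext n Q) (\<lambda>P. xorb a (P (X h)) = g (P (X h'))) c"
    if "h \<in> H" "h' \<in> H" "X h \<noteq> X h'" "a \<in> bits n" for h h' a g
    unfolding c_def by (rule Ext_hit2) (use that bits fresh fin small in auto)
  have c1: "card (fst ` Q) \<le> ?q" "card (snd ` Q) \<le> ?q" using card_image_le fin by blast+
  have "rare (Ext n Q) B ((card H * card (fst ` Q) * c + card H * card H * c) +
      ((card H * card H * c + card H * card (snd ` Q) * c) + (card H * card H * c + card H * card H * c)))"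
    unfolding B_def
  proof (intro rare_disj rare_ex2)
    fix h h' assume h: "h \<in> H" "h' \<in> H"
    show "rare (Ext n Q) (\<lambda>P. X h \<noteq> X h' \<and> xorb (A h) (P (X h)) = xorb (A h') (P (X h'))) c"
      using hit2[OF h, of "A h" "xorb (A h')"] bits(2)[OF h(1)] c
      by (cases "X h = X h'") (auto intro: rare_impossible)
    show "rare (Ext n Q) (\<lambda>P. X (st h) \<noteq> X (st h') \<and> xorb (Y h) (P (X (st h))) = xorb (Y h') (P (X (st h')))) c"
      using hit2[OF st[OF h(1)] st[OF h(2)], of "Y h" "xorb (Y h')"] bits(3)[OF h(1)] c
      by (cases "X (st h) = X (st h')") (auto intro: rare_impossible)
    show "rare (Ext n Q) (\<lambda>P. xorb (Y h) (P (X (st h))) = P (X h')) c"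
    \<comment> \<open>If both sides read P at the same point, the values cancel and the event would
      say that \<open>Y h\<close> is zero, which \<open>Ynz\<close> excludes.\<close>
    proof (cases "X (st h) = X h'")
      case True
      have "xorb (Y h) (P (X h')) \<noteq> P (X h')" if "P \<in> Ext n Q" for P
      proof
        assume eq: "xorb (Y h) (P (X h')) = P (X h')"
        have P: "P (X h') \<in> bits n" using Ext_bits[OF that bits(1)[OF h(2)]] .
        then have "P (X h') \<in> bits n" "xorb (P (X h')) (Y h) = P (X h')"
          using eq by (simp_all add: xorb_commute)
        then have "Y h = zeros n" using xorb_solve[OF P bits(3)[OF h(1)]] xorb_self[OF P] by simp
        then show False using Ynz h by auto
      qed
      then show ?thesis using True c by (intro rare_impossible) auto
    qed (use hit2[OF st[OF h(1)] h(2), of "Y h" "\<lambda>x. x"] h bits(3) in auto)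
  qed (use fin c bits st hit in auto)
  then have "rare (Ext n Q) B (c * (2 * ?m * ?q + 4 * ?m\<^sup>2))"
  proof (rule rare_mono)
    have "card H * card (fst ` Q) * c \<le> ?m * ?q * c" "card H * card (snd ` Q) * c \<le> ?m * ?q * c"
      using c1 c by (auto intro!: mult_right_mono mult_left_mono)
    then show "(card H * card (fst ` Q) * c + card H * card H * c) +
      ((card H * card H * c + card H * card (snd ` Q) * c) + (card H * card H * c + card H * card H * c))
      \<le> c * (2 * ?m * ?q + 4 * ?m\<^sup>2)" by (simp add: algebra_simps power2_eq_square)
  qed auto
  then have "(1 - c * (2 * ?m * ?q + 4 * ?m\<^sup>2)) * card (Ext n Q) \<le> card {P \<in> Ext n Q. \<not> B P}"
    by (rule rare_complement) auto
  moreover have "1 / (2 ^ n) ^ ?m * real (card {P \<in> Ext n Q. \<not> B P}) \<le>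
    card {P \<in> Ext n Q. \<forall>h\<in>H. P (xorb (A h) (P (X h))) = xorb (Y h) (P (X (st h)))}"
  \<comment> \<open>After exposing P on \<open>X\<close>, the inputs and outputs in the remaining
    equations are constants, and outside \<open>B\<close> they are fresh and pairwise
    distinct.\<close>
  proof (rule Ext_refine[where Z = "X ` H"])
    fix P assume P: "P \<in> Ext n Q" and B: "\<not> B P"
    let ?Q = "Q \<union> graph_on P (X ` H)"
    let ?x = "\<lambda>h. xorb (A h) (P (X h))" and ?y = "\<lambda>h. xorb (Y h) (P (X (st h)))"
    have Pb: "h \<in> H \<Longrightarrow> P (X h) \<in> bits n" for h using Ext_bits[OF P bits(1)] .
    have "card (Ext n ?Q) \<le> (2 ^ n) ^ card H * card {P' \<in> Ext n ?Q. \<forall>h\<in>H. P' (?x h) = ?y h}"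
    proof (rule Ext_fresh_family)
      show "inj_on ?x H"
      proof (rule inj_onI, rule ccontr)
        fix h h' assume h: "h \<in> H" "h' \<in> H" "?x h = ?x h'" "h \<noteq> h'"
        then have "X h = X h'" using B unfolding B_def by blast
        then have "A h \<noteq> A h'" using Asep h by blast
        then show False using h \<open>X h = X h'\<close> xorb_inject[of "P (X h)" n "A h" "A h'"] Pb bits
          by (metis xorb_commute)
      qed
      show "inj_on ?y H"
      proof (rule inj_onI, rule ccontr)
        fix h h' assume h: "h \<in> H" "h' \<in> H" "?y h = ?y h'" "h \<noteq> h'"
        then have X: "X (st h) = X (st h')" using B unfolding B_def by blast
        then have "Y h \<noteq> Y h'" using Ysep h by blast
        then show False using h X xorb_inject[of "P (X (st h))" n "Y h" "Y h'"] Pb[OF st] bits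
          by (metis xorb_commute)
      qed
      fix h assume h: "h \<in> H"
      show "?x h \<in> bits n" "?y h \<in> bits n" using h bits st Pb by auto
      show "?x h \<notin> fst ` ?Q" using B h unfolding B_def graph_on_def image_Un by (auto simp: image_image)
      show "?y h \<notin> snd ` ?Q" using B h unfolding B_def graph_on_def image_Un by (auto simp: image_image)
    qed (use fin in auto)
    also have "{P' \<in> Ext n ?Q. \<forall>h\<in>H. P' (?x h) = ?y h} =
      {P' \<in> Ext n ?Q. \<forall>h\<in>H. P' (xorb (A h) (P' (X h))) = xorb (Y h) (P' (X (st h)))}"
    proof -
      have "P' (X h) = P (X h)" if "P' \<in> Ext n ?Q" "h \<in> H" for P' h
        using that by (auto dest: Ext_graph_onD)
      then show ?thesis using st by auto
    qed
    finally have "real (card (Ext n ?Q)) \<le> (2 ^ n) ^ card H *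
      real (card {P' \<in> Ext n ?Q. \<forall>h\<in>H. P' (xorb (A h) (P' (X h))) = xorb (Y h) (P' (X (st h)))})"
      by (metis (mono_tags, lifting) of_nat_le_iff of_nat_mult of_nat_numeral of_nat_power)
    then show "1 / (2 ^ n) ^ ?m * real (card (Ext n ?Q)) \<le>
      card {P' \<in> Ext n ?Q. \<forall>h\<in>H. P' (xorb (A h) (P' (X h))) = xorb (Y h) (P' (X (st h)))}"
      by (simp add: field_simps)
  qed auto
  then have "real (card {P \<in> Ext n Q. \<not> B P}) \<le> (2 ^ n) ^ ?m *
    card {P \<in> Ext n Q. \<forall>h\<in>H. P (xorb (A h) (P (X h))) = xorb (Y h) (P (X (st h)))}"
    by (simp add: field_simps)
  ultimately show ?thesis unfolding c_def by linarith
qed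

text \<open>Here \<open>X\<close> are the inputs of rounds 1 and 6 and \<open>X2\<close> those of
  rounds 2 and 5. The role of \<open>Y\<close> in \<open>second_layer\<close> falls to
  \<open>xorb (C h) (X2 P h)\<close>, so this exposure must also make these words nonzero and
  distinct. \<open>Asep\<close> is where condition (2) enters, and \<open>Xsep\<close> is the
  absence of two-sided collisions.\<close>

lemma first_layer:
  fixes st :: "'h \<Rightarrow> 'h" and X A A' C :: "'h \<Rightarrow> bool list" and Q :: "(bool list \<times> bool list) set"
  defines "X2 \<equiv> \<lambda>P h. xorb (A h) (P (X h))"
  assumes fin: "finite H" "finite Q"
    and st: "\<And>h. h \<in> H \<Longrightarrow> st h \<in> H"
    and bits: "\<And>h. h \<in> H \<Longrightarrow> X h \<in> bits n" "\<And>h. h \<in> H \<Longrightarrow> A h \<in> bits n"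
      "\<And>h. h \<in> H \<Longrightarrow> A' h \<in> bits n" "\<And>h. h \<in> H \<Longrightarrow> C h \<in> bits n"
    and fresh: "\<And>h. h \<in> H \<Longrightarrow> X h \<notin> fst ` Q"
    and Asep: "\<And>h h'. h \<in> H \<Longrightarrow> h' \<in> H \<Longrightarrow> h \<noteq> h' \<Longrightarrow> X h = X h' \<Longrightarrow> A h = A h' \<Longrightarrow> A' h \<noteq> A' h'"
    and Xsep: "\<And>h h'. h \<in> H \<Longrightarrow> h' \<in> H \<Longrightarrow> h \<noteq> h' \<Longrightarrow> X (st h) = X (st h') \<Longrightarrow> X h \<noteq> X h'"
    and small: "H \<noteq> {} \<Longrightarrow> 4 * (card Q + card H + 1) \<le> 2 ^ n"
  shows "(1 - 4 / (3 * 2 ^ n) * (3 * card H * card Q + 9 * (card H)\<^sup>2 + card H)) * card (Ext n Q)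
    \<le> (2 ^ n) ^ card H * card {P \<in> Ext n Q. \<forall>h\<in>H.
        P (xorb (A' h) (P (X2 P h))) = xorb (xorb (C h) (X2 P h)) (P (X2 P (st h)))}"
\<comment> \<open>Without cipher queries no size condition is available, but then there are no
  equations and both sides agree.\<close>
proof (cases "H = {}")
  case True
  then show ?thesis by simp
next
  case False
  define c :: real where "c = 4 / (3 * 2 ^ n)"
  have c: "0 \<le> c" by (simp add: c_def)
  define B where "B P \<longleftrightarrow>
    ((\<exists>h\<in>H. \<exists>v\<in>fst ` Q. X2 P h = v) \<or>
     (\<exists>h\<in>H. \<exists>h'\<in>H. X2 P h = X h')) \<or>
    ((\<exists>h\<in>H. \<exists>h'\<in>H. X h \<noteq> X h' \<and> X2 P h = X2 P h') \<or>
     (\<exists>h\<in>H. \<exists>h'\<in>H. X h \<noteq> X h' \<and> xorb (C h) (X2 P h) = xorb (C h') (X2 P h')) \<or>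
     (\<exists>h\<in>H. xorb (C h) (X2 P h) = zeros n))"
    for P :: "bool list \<Rightarrow> bool list"
  let ?m = "card H" and ?q = "card Q"
  have hit: "rare (Ext n Q) (\<lambda>P. xorb a (P (X h)) = v) c" if "h \<in> H" "a \<in> bits n" for h a v
    unfolding c_def by (rule Ext_hit) (use that bits fresh fin small[OF False] in auto)
  have hit2: "rare (Ext n Q) (\<lambda>P. xorb a (P (X h)) = g (P (X h'))) c"
    if "h \<in> H" "h' \<in> H" "X h \<noteq> X h'" "a \<in> bits n" for h h' a g
    unfolding c_def by (rule Ext_hit2) (use that bits fresh fin small[OF False] in auto)
  have "rare (Ext n Q) B ((card H * card (fst ` Q) * c + card H * card H * c) +
      (card H * card H * c + (card H * card H * c + card H * c)))"
    unfolding B_def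
  proof (intro rare_disj rare_ex2 rare_ex)
    fix h h' assume h: "h \<in> H" "h' \<in> H"
    show "rare (Ext n Q) (\<lambda>P. X h \<noteq> X h' \<and> X2 P h = X2 P h') c"
      using hit2[OF h, of "A h" "xorb (A h')"] bits(2)[OF h(1)] c
      unfolding X2_def by (cases "X h = X h'") (auto intro: rare_impossible)
    show "rare (Ext n Q) (\<lambda>P. X h \<noteq> X h' \<and> xorb (C h) (X2 P h) = xorb (C h') (X2 P h')) c"
      using hit2[OF h, of "xorb (C h) (A h)" "xorb (xorb (C h') (A h'))"] bits(2,4)[OF h(1)] c
      unfolding X2_def xorb_assoc[symmetric] by (cases "X h = X h'") (auto intro: rare_impossible)
  next
    fix h assume h: "h \<in> H"
    show "rare (Ext n Q) (\<lambda>P. xorb (C h) (X2 P h) = zeros n) c"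
      using hit[OF h, of "xorb (C h) (A h)"] bits(2,4)[OF h]
      unfolding X2_def xorb_assoc[symmetric] by auto
  qed (use fin c bits hit in \<open>auto simp: X2_def\<close>)
  then have "rare (Ext n Q) B (c * (?m * ?q + 3 * ?m\<^sup>2 + ?m))"
  proof (rule rare_mono)
    have "card H * card (fst ` Q) * c \<le> ?m * ?q * c"
      using card_image_le[OF fin(2), of fst] c by (auto intro!: mult_right_mono mult_left_mono)
    then show "(card H * card (fst ` Q) * c + card H * card H * c) +
      (card H * card H * c + (card H * card H * c + card H * c))
      \<le> c * (?m * ?q + 3 * ?m\<^sup>2 + ?m)" by (simp add: algebra_simps power2_eq_square)
  qed auto
  then have first: "(1 - c * (?m * ?q + 3 * ?m\<^sup>2 + ?m)) * card (Ext n Q) \<le> card {P \<in> Ext n Q. \<not> B P}"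
    by (rule rare_complement) auto
  define e1 where "e1 = c * (?m * ?q + 3 * ?m\<^sup>2 + ?m)"
  \<comment> \<open>The second exposure starts from a table with up to m additional points, and 2m(q
    + m) + 4m^2 = 2mq + 6m^2.\<close>
  define e2 where "e2 = c * (2 * ?m * ?q + 6 * ?m\<^sup>2)"
  define W where "W P \<longleftrightarrow> (\<forall>h\<in>H. P (xorb (A' h) (P (X2 P h))) = xorb (xorb (C h) (X2 P h)) (P (X2 P (st h))))" for P
  have e: "c * (3 * ?m * ?q + 9 * ?m\<^sup>2 + ?m) = e1 + e2" "e1 \<ge> 0" "e2 \<ge> 0"
    using c by (simp_all add: e1_def e2_def algebra_simps)
  have goal: "(1 - (e1 + e2)) * card (Ext n Q) \<le> (2 ^ n) ^ ?m * card {P \<in> Ext n Q. W P}"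
  \<comment> \<open>\<open>Ext_refine\<close> needs a nonnegative factor; for \<open>e2\<close>
    above 1 the left side is not positive.\<close>
  proof (cases "e2 \<le> 1")
    case False
    then have "(1 - (e1 + e2)) * card (Ext n Q) \<le> 0" using e by (intro mult_nonpos_nonneg) auto
    then show ?thesis by (smt (verit) of_nat_0_le_iff mult_nonneg_nonneg zero_le_power)
  next
    case True
    have "(1 - e2) / (2 ^ n) ^ ?m * real (card {P \<in> Ext n Q. \<not> B P}) \<le> card {P \<in> Ext n Q. W P}"
    proof (rule Ext_refine[where Z = "X ` H"])
      fix P assume P: "P \<in> Ext n Q" and B: "\<not> B P"
      let ?Q = "Q \<union> graph_on P (X ` H)"
      have X2b: "X2 P h \<in> bits n" if "h \<in> H" for h
        using that bits Ext_bits[OF P] by (auto simp: X2_def)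
      have "card ?Q \<le> card Q + card (graph_on P (X ` H))" by (rule card_Un_le)
      also have "card (graph_on P (X ` H)) \<le> card H"
        unfolding graph_on_def image_image using fin by (intro card_image_le) auto
      finally have cQ: "card ?Q \<le> ?q + ?m" by simp
      have Xeq: "X h = X h'" if "h \<in> H" "h' \<in> H" "X2 P h = X2 P h'" for h h'
        using that B unfolding B_def by blast
      have "(1 - 4 / (3 * 2 ^ n) * (2 * card H * card ?Q + 4 * (card H)\<^sup>2)) * card (Ext n ?Q)
        \<le> (2 ^ n) ^ card H * card {P' \<in> Ext n ?Q. \<forall>h\<in>H.
          P' (xorb (A' h) (P' (X2 P h))) = xorb (xorb (C h) (X2 P h)) (P' (X2 P (st h)))}"
      proof (rule second_layer)
        show "finite ?Q" using fin by (simp add: graph_on_def)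
        show "4 * (card ?Q + 1) \<le> 2 ^ n" by (rule order_trans[OF _ small[OF False]]) (use cQ in simp)
        fix h assume h: "h \<in> H"
        show "X2 P h \<notin> fst ` ?Q" using B h unfolding B_def graph_on_def image_Un by (auto simp: image_image)
        show "xorb (C h) (X2 P h) \<noteq> zeros n" using B h unfolding B_def by blast
        show "X2 P h \<in> bits n" "xorb (C h) (X2 P h) \<in> bits n" using X2b[OF h] bits(4)[OF h] by auto
        fix h' assume h': "h' \<in> H" "h \<noteq> h'"
        show "A' h \<noteq> A' h'" if "X2 P h = X2 P h'"
        proof -
          have X: "X h = X h'" by (rule Xeq[OF h h'(1) that])
          have "xorb (P (X h)) (A h) = xorb (P (X h)) (A h')"
            using that X by (simp add: X2_def xorb_commute)
          then have "A h = A h'"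
            using xorb_inject[OF Ext_bits[OF P bits(1)] bits(2) bits(2), OF h h h'(1)] by simp
          then show ?thesis using Asep[OF h h' X] by blast
        qed
        \<comment> \<open>Outside \<open>B\<close>, agreement of the other ends in \<open>X2\<close>
          goes back to agreement in \<open>X\<close>. By \<open>Xsep\<close> the ends at hand then
          differ in \<open>X\<close>, and for such pairs \<open>B\<close> contains the coincidence
          of these words.\<close>
        show "xorb (C h) (X2 P h) \<noteq> xorb (C h') (X2 P h')" if "X2 P (st h) = X2 P (st h')"
        proof -
          have "X (st h) = X (st h')" by (rule Xeq[OF st[OF h] st[OF h'(1)] that])
          then have "X h \<noteq> X h'" by (rule Xsep[OF h h'])
          then show ?thesis using B h h' unfolding B_def by blast
        qed
      qed (use fin st bits in auto)
      moreover have "4 / (3 * 2 ^ n) * (2 * card H * card ?Q + 4 * (card H)\<^sup>2) \<le> e2"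
      proof -
        have "2 * ?m * card ?Q + 4 * ?m\<^sup>2 \<le> 2 * ?m * (?q + ?m) + 4 * ?m\<^sup>2"
          using cQ by simp
        also have "\<dots> = 2 * ?m * ?q + 6 * ?m\<^sup>2" by (simp add: algebra_simps power2_eq_square)
        finally have "real (2 * ?m * card ?Q + 4 * ?m\<^sup>2) \<le> real (2 * ?m * ?q + 6 * ?m\<^sup>2)"
          by (simp only: of_nat_le_iff)
        then have "c * real (2 * ?m * card ?Q + 4 * ?m\<^sup>2) \<le> c * real (2 * ?m * ?q + 6 * ?m\<^sup>2)"
          using c by (rule mult_left_mono)
        then show ?thesis by (simp add: c_def e2_def)
      qed
      then have "(1 - e2) * card (Ext n ?Q) \<le>
          (1 - 4 / (3 * 2 ^ n) * (2 * card H * card ?Q + 4 * (card H)\<^sup>2)) * card (Ext n ?Q)"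
        by (intro mult_right_mono) auto
      moreover have "{P' \<in> Ext n ?Q. \<forall>h\<in>H.
          P' (xorb (A' h) (P' (X2 P h))) = xorb (xorb (C h) (X2 P h)) (P' (X2 P (st h)))} = {P' \<in> Ext n ?Q. W P'}"
      proof -
        have "X2 P' h = X2 P h" if "P' \<in> Ext n ?Q" "h \<in> H" for P' h
          using that by (auto dest: Ext_graph_onD simp: X2_def)
        then show ?thesis using st by (auto simp: W_def)
      qed
      ultimately have "(1 - e2) * card (Ext n ?Q) \<le> (2 ^ n) ^ card H * card {P' \<in> Ext n ?Q. W P'}"
        by simp
      then show "(1 - e2) / (2 ^ n) ^ ?m * real (card (Ext n ?Q)) \<le> card {P' \<in> Ext n ?Q. W P'}"
        by (simp add: field_simps)
    qed (use True in auto)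
    then have "(1 - e2) * real (card {P \<in> Ext n Q. \<not> B P}) \<le> (2 ^ n) ^ ?m * card {P \<in> Ext n Q. W P}"
      by (simp add: field_simps)
    moreover have "(1 - e2) * ((1 - e1) * card (Ext n Q)) \<le> (1 - e2) * real (card {P \<in> Ext n Q. \<not> B P})"
      using first True unfolding e1_def by (intro mult_left_mono) auto
    moreover have "(1 - (e1 + e2)) * card (Ext n Q) \<le> (1 - e2) * ((1 - e1) * card (Ext n Q))"
      unfolding mult.assoc[symmetric] using mult_nonneg_nonneg[OF e(2,3)]
      by (intro mult_right_mono) (simp_all add: algebra_simps)
    ultimately show ?thesis by linarith
  qed
  then show ?thesis
    unfolding e(1)[unfolded c_def] W_def .
qed

subsection \<open>Distinguishers and transcript weights\<close>

type_synonym epairs = "(bool list \<times> bool list \<times> bool list) set"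
type_synonym ppairs = "(bool list \<times> bool list) set"

definition valid_P :: "nat \<Rightarrow> ppairs \<Rightarrow> bool" where
  "valid_P n Q \<longleftrightarrow> finite Q \<and> Q \<subseteq> bits n \<times> bits n"

definition valid_E :: "nat \<Rightarrow> epairs \<Rightarrow> bool" where
  "valid_E n U \<longleftrightarrow> finite U \<and> U \<subseteq> bits n \<times> bits (2 * n) \<times> bits (2 * n)"

definition well_formed :: "nat \<Rightarrow> query \<Rightarrow> bool" where
  "well_formed n q = (case q of PFwd x \<Rightarrow> x \<in> bits n | PInv y \<Rightarrow> y \<in> bits n
     | EFwd d w \<Rightarrow> d \<in> bits n \<and> w \<in> bits (2 * n) | EInv d s \<Rightarrow> d \<in> bits n \<and> s \<in> bits (2 * n))"

definition responses :: "nat \<Rightarrow> query \<Rightarrow> bool list set" where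
  "responses n q = (if is_Pquery q then bits n else bits (2 * n))"

definition record_P :: "query \<Rightarrow> bool list \<Rightarrow> ppairs \<Rightarrow> ppairs" where
  "record_P q r Q = (case q of PFwd x \<Rightarrow> insert (x, r) Q | PInv y \<Rightarrow> insert (r, y) Q | _ \<Rightarrow> Q)"

definition record_E :: "query \<Rightarrow> bool list \<Rightarrow> epairs \<Rightarrow> epairs" where
  "record_E q r U = (case q of EFwd d w \<Rightarrow> insert (d, w, r) U | EInv d s \<Rightarrow> insert (d, r, s) U | _ \<Rightarrow> U)"

lemma valid_record:
  assumes "well_formed n q" "r \<in> responses n q"
  shows "valid_P n Q \<Longrightarrow> valid_P n (record_P q r Q)" "valid_E n U \<Longrightarrow> valid_E n (record_E q r U)"
  using assms by (cases q; simp add: valid_P_def valid_E_def well_formed_def responses_def record_P_def record_E_def)+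

lemma finite_responses [simp]: "finite (responses n q)"
  by (simp add: responses_def)

locale oracle_world =
  fixes n :: nat and \<Omega> :: "'w set" and prm :: "'w \<Rightarrow> bool list \<Rightarrow> bool list"
    and cip :: "'w \<Rightarrow> bool list \<Rightarrow> bool list \<Rightarrow> bool list"
  assumes finite_\<Omega>: "finite \<Omega>"
    and prm: "\<omega> \<in> \<Omega> \<Longrightarrow> prm \<omega> permutes bits n"
    and cip: "\<omega> \<in> \<Omega> \<Longrightarrow> d \<in> bits n \<Longrightarrow> bij_betw (cip \<omega> d) (bits (2 * n)) (bits (2 * n))"
begin

definition cons :: "ppairs \<Rightarrow> epairs \<Rightarrow> 'w set" where
  "cons Q U = {\<omega> \<in> \<Omega>. (\<forall>(x, y)\<in>Q. prm \<omega> x = y) \<and> (\<forall>(d, w, s)\<in>U. cip \<omega> d w = s)}"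

text \<open>\<open>cip\<close> is indexed by the offset and has the secret key built in; the zero
  key makes \<open>answer\<close> pass the offset on unchanged.\<close>

definition ans :: "'w \<Rightarrow> query \<Rightarrow> bool list" where
  "ans \<omega> = answer n (prm \<omega>) (cip \<omega>) (zeros n)"

definition wt :: "ppairs \<Rightarrow> epairs \<Rightarrow> real" where
  "wt Q U = card (cons Q U) / card \<Omega>"

text \<open>A joint rather than a conditional probability: the world fits the transcript and
  \<open>D\<close>, continued from there, outputs \<open>b\<close>. Such quantities add up over the
  responses without dividing by a weight that may vanish.\<close>

definition val :: "bool \<Rightarrow> dist \<Rightarrow> ppairs \<Rightarrow> epairs \<Rightarrow> real" where
  "val b D Q U = (\<Sum>\<omega>\<in>cons Q U. pmf (run (ans \<omega>) D) b) / card \<Omega>"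

lemma finite_cons [simp]: "finite (cons Q U)"
  using finite_\<Omega> by (simp add: cons_def)

lemma wt_nonneg [simp]: "0 \<le> wt Q U"
  by (simp add: wt_def)

lemma val_nonneg: "0 \<le> val b D Q U"
  by (simp add: val_def sum_nonneg)

lemma val_le_wt: "val b D Q U \<le> wt Q U"
proof -
  have "(\<Sum>\<omega>\<in>cons Q U. pmf (run (ans \<omega>) D) b) \<le> (\<Sum>\<omega>\<in>cons Q U. 1)"
    by (rule sum_mono) (simp add: pmf_le_1)
  then show ?thesis by (simp add: val_def wt_def divide_right_mono)
qed

lemma ans_malformed: "\<not> well_formed n q \<Longrightarrow> ans \<omega> q = []"
  by (cases q) (auto simp: ans_def answer_def well_formed_def)

lemma ans_responses:
  assumes "\<omega> \<in> \<Omega>" "well_formed n q"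
  shows "ans \<omega> q \<in> responses n q"
proof -
  have "bij_betw (prm \<omega>) (bits n) (bits n)" using prm[OF assms(1)] by (rule permutes_imp_bij)
  then show ?thesis
    using assms cip[OF assms(1)]
    by (cases q) (auto simp: ans_def answer_def well_formed_def responses_def xorb_zeros
      intro: bij_betw_apply bij_betw_apply[OF bij_betw_inv_into])
qed

lemma inv_into_eq_iff:
  assumes "bij_betw f A A" "y \<in> A" "r \<in> A"
  shows "inv_into A f y = r \<longleftrightarrow> f r = y"
  using assms by (auto simp: bij_betw_def f_inv_into_f)

text \<open>An inverse answer is equivalent to the forward equation stored for it, because all maps
  involved are bijections. Transcripts can thus be plain sets that forget direction, order and
  repetition.\<close>

lemma cons_record:
  assumes "well_formed n q" "r \<in> responses n q"
  shows "cons (record_P q r Q) (record_E q r U) = {\<omega> \<in> cons Q U. ans \<omega> q = r}"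
proof -
  have P: "inv_into (bits n) (prm \<omega>) y = x \<longleftrightarrow> prm \<omega> x = y"
    if "\<omega> \<in> \<Omega>" "y \<in> bits n" "x \<in> bits n" for \<omega> x y
    using permutes_imp_bij[OF prm[OF that(1)]] that by (intro inv_into_eq_iff)
  have E: "inv_into (bits (2 * n)) (cip \<omega> d) y = x \<longleftrightarrow> cip \<omega> d x = y"
    if "\<omega> \<in> \<Omega>" "d \<in> bits n" "y \<in> bits (2 * n)" "x \<in> bits (2 * n)" for \<omega> d x y
    using cip[OF that(1,2)] that by (intro inv_into_eq_iff)
  show ?thesis
    using assms P E
    by (cases q) (auto simp: cons_def ans_def answer_def well_formed_def responses_def record_P_def
      record_E_def xorb_zeros intro: E[THEN iffD1, OF _ _ _ _ refl])
qed

lemma sum_cons_record: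
  fixes f :: "'w \<Rightarrow> bool list \<Rightarrow> real"
  assumes "well_formed n q"
  shows "(\<Sum>\<omega>\<in>cons Q U. f \<omega> (ans \<omega> q)) =
    (\<Sum>r\<in>responses n q. \<Sum>\<omega>\<in>cons (record_P q r Q) (record_E q r U). f \<omega> r)"
proof -
  have "ans \<omega> q \<in> responses n q" if "\<omega> \<in> cons Q U" for \<omega>
    using ans_responses that assms by (auto simp: cons_def)
  then have "(\<Sum>\<omega>\<in>cons Q U. f \<omega> (ans \<omega> q)) =
    (\<Sum>r\<in>responses n q. \<Sum>\<omega>\<in>{\<omega> \<in> cons Q U. ans \<omega> q = r}. f \<omega> (ans \<omega> q))"
    by (subst sum.group) auto
  also have "\<dots> = (\<Sum>r\<in>responses n q. \<Sum>\<omega>\<in>cons (record_P q r Q) (record_E q r U). f \<omega> r)"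
    by (intro sum.cong refl) (use assms in \<open>auto simp: cons_record\<close>)
  finally show ?thesis .
qed

lemma wt_record:
  assumes "well_formed n q"
  shows "wt Q U = (\<Sum>r\<in>responses n q. wt (record_P q r Q) (record_E q r U))"
  using sum_cons_record[OF assms, of "\<lambda>_ _. 1" Q U] by (simp add: wt_def sum_divide_distrib)

lemma val_Ask:
  assumes "well_formed n q"
  shows "val b (Ask q g) Q U = (\<Sum>r\<in>responses n q. val b (g r) (record_P q r Q) (record_E q r U))"
  using sum_cons_record[OF assms, of "\<lambda>\<omega> r. pmf (run (ans \<omega>) (g r)) b" Q U]
  by (simp add: val_def sum_divide_distrib)

lemma val_Ask_malformed: "\<not> well_formed n q \<Longrightarrow> val b (Ask q g) Q U = val b (g []) Q U"
  by (simp add: val_def ans_malformed)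

lemma val_Out: "val b (Out b') Q U = (if b = b' then wt Q U else 0)"
  by (simp add: val_def wt_def)

lemma val_Coin: "val b (Coin g) Q U = (val b (g True) Q U + val b (g False) Q U) / 2"
  by (simp add: val_def pmf_bind sum.distrib sum_divide_distrib add_divide_distrib mult.commute)

end

text \<open>\<open>ratio\<close> is the H-coefficient inequality for collision-free transcripts, and
  \<open>\<kappa>\<close> is the price of one cipher query whose answer may create a collision. The
  budgets \<open>qf\<close> and \<open>qe\<close> bound the size of every transcript met on the
  way.\<close>

locale two_worlds =
  R: oracle_world n \<Omega>R prmR cipR + I: oracle_world n \<Omega>I prmI cipI
  for n \<Omega>R prmR cipR \<Omega>I prmI cipI +
  fixes coll :: "epairs \<Rightarrow> bool" and \<epsilon> \<kappa> :: real and qf qe :: nat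
  assumes nonneg: "0 \<le> \<epsilon>" "0 \<le> \<kappa>"
    and ratio: "\<lbrakk>valid_P n Q; valid_E n U; card Q \<le> qf; card U \<le> qe; \<not> coll U; 0 < I.wt Q U\<rbrakk>
      \<Longrightarrow> (1 - \<epsilon>) * I.wt Q U \<le> R.wt Q U"
    and collision: "\<lbrakk>valid_P n Q; valid_E n U; card U < qe; \<not> coll U; well_formed n q; \<not> is_Pquery q\<rbrakk>
      \<Longrightarrow> (\<Sum>r | r \<in> responses n q \<and> coll (record_E q r U). I.wt Q (record_E q r U)) \<le> \<kappa> * I.wt Q U"
begin

text \<open>Along the decision tree \<open>\<epsilon>\<close> is paid once, at the leaves, and
  \<open>\<kappa>\<close> at each remaining cipher query. A branch whose answer creates a collision
  is given up: its real value is at least 0 and its ideal value at most its weight.\<close>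

lemma val_difference:
  "\<lbrakk>query_bounded D qf' qe'; card Q + qf' \<le> qf; card U + qe' \<le> qe; valid_P n Q; valid_E n U; \<not> coll U\<rbrakk>
   \<Longrightarrow> I.val b D Q U - R.val b D Q U \<le> (\<epsilon> + \<kappa> * real qe') * I.wt Q U"
proof (induction D arbitrary: qf' qe' Q U)
  case (Out b')
  show ?case
  proof (cases "b = b' \<and> 0 < I.wt Q U")
    case True
    have "(1 - \<epsilon>) * I.wt Q U \<le> R.wt Q U" by (rule ratio) (use Out True in auto)
    moreover have "0 \<le> \<kappa> * real qe' * I.wt Q U" using nonneg by simp
    ultimately show ?thesis using True by (simp add: I.val_Out R.val_Out algebra_simps)
  next
    case False
    then have "I.val b (Out b') Q U \<le> 0" using I.wt_nonneg[of Q U] by (auto simp: I.val_Out)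
    moreover have "0 \<le> (\<epsilon> + \<kappa> * real qe') * I.wt Q U" using nonneg by simp
    ultimately show ?thesis using R.val_nonneg[of b "Out b'" Q U] by linarith
  qed
next
  case (Coin g)
  have "I.val b (g c) Q U - R.val b (g c) Q U \<le> (\<epsilon> + \<kappa> * real qe') * I.wt Q U" for c
    by (rule Coin.IH) (use Coin.prems in auto)
  moreover have "(x + y) / 2 - (u + v) / 2 \<le> e" if "x - u \<le> e" "y - v \<le> e" for x y u v e :: real
    using that by (simp add: field_simps)
  ultimately show ?case
    unfolding I.val_Coin R.val_Coin by blast
next
  case (Ask q g)
  have mono: "(\<epsilon> + \<kappa> * real (qe' - 1)) * I.wt Q U \<le> (\<epsilon> + \<kappa> * real qe') * I.wt Q U"
    using nonneg by (intro mult_right_mono add_left_mono mult_left_mono) auto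
  show ?case
  \<comment> \<open>A malformed query gets the same fixed answer in both worlds; it uses up budget
    but leaves the transcript unchanged.\<close>
  proof (cases "well_formed n q")
    case False
    show ?thesis
    proof (cases "is_Pquery q")
      case True
      then have "I.val b (g []) Q U - R.val b (g []) Q U \<le> (\<epsilon> + \<kappa> * real qe') * I.wt Q U"
        using Ask.prems by (intro Ask.IH[of _ "qf' - 1"]) auto
      then show ?thesis by (simp add: False I.val_Ask_malformed R.val_Ask_malformed)
    next
      case P: False
      then have "I.val b (g []) Q U - R.val b (g []) Q U \<le> (\<epsilon> + \<kappa> * real (qe' - 1)) * I.wt Q U"
        using Ask.prems by (intro Ask.IH[of _ qf']) auto
      then show ?thesis using mono by (simp add: False I.val_Ask_malformed R.val_Ask_malformed)
    qed
  next
    case wf: True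
    let ?Q = "\<lambda>r. record_P q r Q" and ?U = "\<lambda>r. record_E q r U" and ?R = "responses n q"
    have diff: "I.val b (Ask q g) Q U - R.val b (Ask q g) Q U =
      (\<Sum>r\<in>?R. I.val b (g r) (?Q r) (?U r) - R.val b (g r) (?Q r) (?U r))"
      by (simp add: I.val_Ask R.val_Ask wf sum_subtractf)
    show ?thesis
    proof (cases "is_Pquery q")
      case True
      have U: "?U r = U" for r using True by (cases q) (auto simp: record_E_def)
      have c: "card (?Q r) \<le> Suc (card Q)" for r
        using Ask.prems(4) True by (cases q) (auto simp: record_P_def card_insert_if valid_P_def)
      have "I.val b (Ask q g) Q U - R.val b (Ask q g) Q U \<le>
        (\<Sum>r\<in>?R. (\<epsilon> + \<kappa> * real qe') * I.wt (?Q r) (?U r))"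
        unfolding diff
      proof (rule sum_mono)
        fix r assume "r \<in> ?R"
        then show "I.val b (g r) (?Q r) (?U r) - R.val b (g r) (?Q r) (?U r) \<le> (\<epsilon> + \<kappa> * real qe') * I.wt (?Q r) (?U r)"
          using Ask.prems True c[of r] valid_record[OF wf] unfolding U by (intro Ask.IH[of _ "qf' - 1"]) auto
      qed
      also have "\<dots> = (\<epsilon> + \<kappa> * real qe') * I.wt Q U"
        unfolding I.wt_record[OF wf, of Q U] by (simp add: sum_distrib_left)
      finally show ?thesis .
    next
      case False
      have Q: "?Q r = Q" for r using False by (cases q) (auto simp: record_P_def)
      have c: "card (?U r) \<le> Suc (card U)" for r
        using Ask.prems(5) False by (cases q) (auto simp: record_E_def card_insert_if valid_E_def)
      have qe': "0 < qe'" using Ask.prems(1) False by auto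
      have "I.val b (Ask q g) Q U - R.val b (Ask q g) Q U \<le>
        (\<Sum>r\<in>?R. (\<epsilon> + \<kappa> * real (qe' - 1)) * I.wt (?Q r) (?U r) + (if coll (?U r) then I.wt (?Q r) (?U r) else 0))"
        unfolding diff
      proof (rule sum_mono)
        fix r assume r: "r \<in> ?R"
        show "I.val b (g r) (?Q r) (?U r) - R.val b (g r) (?Q r) (?U r) \<le>
          (\<epsilon> + \<kappa> * real (qe' - 1)) * I.wt (?Q r) (?U r) + (if coll (?U r) then I.wt (?Q r) (?U r) else 0)"
        proof (cases "coll (?U r)")
          case True
          have "0 \<le> (\<epsilon> + \<kappa> * real (qe' - 1)) * I.wt (?Q r) (?U r)" using nonneg by simp
          then show ?thesis using True I.val_le_wt[of b "g r" "?Q r" "?U r"] R.val_nonneg[of b "g r" "?Q r" "?U r"]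
            by auto
        next
          case nc: False
          have "I.val b (g r) (?Q r) (?U r) - R.val b (g r) (?Q r) (?U r) \<le>
            (\<epsilon> + \<kappa> * real (qe' - 1)) * I.wt (?Q r) (?U r)"
            using Ask.prems False c[of r] valid_record[OF wf r] nc unfolding Q by (intro Ask.IH[of _ qf']) auto
          then show ?thesis using nc by simp
        qed
      qed
      also have "\<dots> = (\<epsilon> + \<kappa> * real (qe' - 1)) * I.wt Q U + (\<Sum>r | r \<in> ?R \<and> coll (?U r). I.wt Q (?U r))"
        unfolding I.wt_record[OF wf, of Q U] Q
        by (simp add: sum_distrib_left sum.distrib sum.inter_filter)
      also have "\<dots> \<le> (\<epsilon> + \<kappa> * real (qe' - 1)) * I.wt Q U + \<kappa> * I.wt Q U"
        using collision[OF Ask.prems(4,5) _ Ask.prems(6) wf False] Ask.prems(3) qe' by simp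
      also have "\<dots> = (\<epsilon> + \<kappa> * real qe') * I.wt Q U"
        using qe' by (simp add: algebra_simps)
      finally show ?thesis .
    qed
  qed
qed

end

subsection \<open>Random blockciphers\<close>

lemma finite_blockciphers [simp]: "finite (blockciphers n)"
proof (rule finite_subset)
  show "blockciphers n \<subseteq> {E. \<forall>k. (k \<in> bits n \<longrightarrow> E k \<in> {p. p permutes bits (2 * n)}) \<and> (k \<notin> bits n \<longrightarrow> E k = id)}"
    by (auto simp: blockciphers_def)
  show "finite \<dots>" by (rule finite_set_of_finite_funs) (simp_all add: finite_permutations)
qed

lemma blockciphers_nonempty: "blockciphers n \<noteq> {}"
proof -
  have "(\<lambda>_. id) \<in> blockciphers n" by (simp add: blockciphers_def permutes_id)
  then show ?thesis by blast
qed

definition ExtIC :: "nat \<Rightarrow> bool list \<Rightarrow> epairs \<Rightarrow> (bool list \<Rightarrow> bool list \<Rightarrow> bool list) set" where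
  "ExtIC n k U = {E \<in> blockciphers n. \<forall>(d, w, s)\<in>U. E (xorb k d) w = s}"

lemma finite_ExtIC [simp]: "finite (ExtIC n k U)"
  by (simp add: ExtIC_def)

lemma ExtIC_permutes: "E \<in> ExtIC n k U \<Longrightarrow> k \<in> bits n \<Longrightarrow> d \<in> bits n \<Longrightarrow> E (xorb k d) permutes bits (2 * n)"
  by (simp add: ExtIC_def blockciphers_def)

lemma ExtIC_insert: "ExtIC n k (insert (d, w, s) U) = {E \<in> ExtIC n k U. E (xorb k d) w = s}"
  by (auto simp: ExtIC_def)

text \<open>The transposition argument at the single key \<open>xorb k d\<close>. Other offsets
  address other keys, and recorded pairs with offset \<open>d\<close> have outputs different from
  both \<open>s\<close> and \<open>s'\<close>.\<close>

lemma ExtIC_swap: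
  assumes k: "k \<in> bits n" and U: "valid_E n U" and "d \<in> bits n" "s \<in> bits (2 * n)" "s' \<in> bits (2 * n)"
    and w: "\<And>s. (d, w, s) \<notin> U" and s': "\<And>w. (d, w, s') \<notin> U"
  shows "card (ExtIC n k (insert (d, w, s) U)) \<le> card (ExtIC n k (insert (d, w, s') U))"
proof (rule card_inj_on_le)
  let ?k = "xorb k d" and ?t = "Transposition.transpose s s'"
  let ?f = "\<lambda>E. E(?k := ?t \<circ> E ?k)"
  have kd: "?k \<in> bits n" using assms by simp
  show "?f ` ExtIC n k (insert (d, w, s) U) \<subseteq> ExtIC n k (insert (d, w, s') U)"
  proof
    fix E' assume "E' \<in> ?f ` ExtIC n k (insert (d, w, s) U)"
    then obtain E where E: "E \<in> ExtIC n k U" "E ?k w = s" "E' = ?f E"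
      by (auto simp: ExtIC_insert)
    have perm: "E ?k permutes bits (2 * n)" using E k assms(3) by (intro ExtIC_permutes)
    have "?t \<circ> E ?k permutes bits (2 * n)"
      using perm assms by (intro permutes_compose permutes_swap_id)
    then have "E' \<in> blockciphers n"
      using E kd by (auto simp: ExtIC_def blockciphers_def)
    moreover have "E' (xorb k d') w' = s''" if t: "(d', w', s'') \<in> U" for d' w' s''
    proof -
      have eq: "E (xorb k d') w' = s''" using E t by (auto simp: ExtIC_def)
      show ?thesis
      proof (cases "xorb k d' = ?k")
        case True
        have "d' \<in> bits n" using U t by (auto simp: valid_E_def)
        then have d: "d' = d" using True xorb_inject k assms(3) by blast
        then have "w' \<noteq> w" "s'' \<noteq> s'" using w s' t by auto
        moreover have "s'' \<noteq> s"
          using eq E(2) d \<open>w' \<noteq> w\<close> permutes_inj[OF perm] by (auto dest: injD)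
        ultimately show ?thesis using eq d E(3) by (simp add: Transposition.transpose_def)
      qed (use eq E(3) in simp)
    qed
    ultimately show "E' \<in> ExtIC n k (insert (d, w, s') U)"
      using E by (auto simp: ExtIC_def)
  qed
  show "inj_on ?f (ExtIC n k (insert (d, w, s) U))"
  proof (rule inj_onI)
    fix E E' :: "bool list \<Rightarrow> bool list \<Rightarrow> bool list" assume eq: "?f E = ?f E'"
    have "?t \<circ> E ?k = ?t \<circ> E' ?k" using fun_cong[OF eq, of ?k] by simp
    then have "E ?k = E' ?k" by (metis comp_assoc transpose_comp_involutory id_comp)
    moreover have "E x = E' x" if "x \<noteq> ?k" for x using fun_cong[OF eq, of x] that by simp
    ultimately have "E x = E' x" for x by (cases "x = ?k") simp_all
    then show "E = E'" by (rule ext)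
  qed
qed simp

lemma ExtIC_fresh:
  assumes k: "k \<in> bits n" and U: "valid_E n U" and t: "d \<in> bits n" "w \<in> bits (2 * n)" "s \<in> bits (2 * n)"
    and new: "(d, w, s) \<notin> U"
  shows "(2 ^ (2 * n) - card U) * card (ExtIC n k (insert (d, w, s) U)) \<le> card (ExtIC n k U)"
\<comment> \<open>A new triple that shares its offset and its input or output with a recorded one
  contradicts that the cipher is a permutation for each key.\<close>
proof (cases "(\<exists>s'. (d, w, s') \<in> U) \<or> (\<exists>w'. (d, w', s) \<in> U)")
  case True
  have "E \<notin> ExtIC n k (insert (d, w, s) U)" for E
  proof
    assume E: "E \<in> ExtIC n k (insert (d, w, s) U)"
    have inj: "inj (E (xorb k d))" using permutes_inj[OF ExtIC_permutes[OF E k t(1)]] .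
    have eq: "E (xorb k d) a = b" if "(d, a, b) \<in> insert (d, w, s) U" for a b
      using E that by (auto simp: ExtIC_def)
    from True show False
    proof (elim disjE exE)
      fix s' assume "(d, w, s') \<in> U"
      then show False using eq[of w s] eq[of w s'] new by auto
    next
      fix w' assume "(d, w', s) \<in> U"
      then show False using eq[of w s] eq[of w' s] new injD[OF inj, of w w'] by auto
    qed
  qed
  then have none: "ExtIC n k (insert (d, w, s) U) = {}" by blast
  show ?thesis unfolding none by simp
next
  case False
  \<comment> \<open>Outputs recorded under any offset are excluded, not only those under
    \<open>d\<close>. This is cruder but still excludes at most \<open>card U\<close>
    values.\<close>
  let ?S = "(snd \<circ> snd) ` U"
  have finU: "finite U" using U by (simp add: valid_E_def)
  have "2 ^ (2 * n) - card U \<le> card (bits (2 * n) - ?S)"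
    using diff_card_le_card_Diff[of ?S "bits (2 * n)"] card_image_le[OF finU, of "snd \<circ> snd"] finU
    by (simp add: card_bits)
  then have "(2 ^ (2 * n) - card U) * card (ExtIC n k (insert (d, w, s) U)) \<le>
      (\<Sum>s'\<in>bits (2 * n) - ?S. card (ExtIC n k (insert (d, w, s) U)))" by simp
  also have "\<dots> \<le> (\<Sum>s'\<in>bits (2 * n) - ?S. card (ExtIC n k (insert (d, w, s') U)))"
  proof (rule sum_mono)
    fix s' assume s': "s' \<in> bits (2 * n) - ?S"
    then have "(d, w', s') \<notin> U" for w' by force
    then show "card (ExtIC n k (insert (d, w, s) U)) \<le> card (ExtIC n k (insert (d, w, s') U))"
      using False s' t by (intro ExtIC_swap k U) auto
  qed
  also have "\<dots> \<le> (\<Sum>s'\<in>bits (2 * n). card {E \<in> ExtIC n k U. E (xorb k d) w = s'})"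
    unfolding ExtIC_insert by (rule sum_mono2) auto
  also have "\<dots> = card (ExtIC n k U)"
    by (rule card_partition_bounded[symmetric])
      (use ExtIC_permutes k t in \<open>auto simp: permutes_in_image\<close>)
  finally show ?thesis .
qed

text \<open>The common bound \<open>q\<close> stays fixed as \<open>U\<close> shrinks in the
  induction, so that all factors are equal and form a power.\<close>

lemma ExtIC_upper:
  assumes k: "k \<in> bits n" and U: "valid_E n U" and q: "card U \<le> q"
  shows "(2 ^ (2 * n) - q) ^ card U * card (ExtIC n k U) \<le> card (blockciphers n)"
proof -
  have "finite U" using U by (simp add: valid_E_def)
  then show ?thesis using U q
  proof (induction U rule: finite_induct)
    case empty
    then show ?case by (simp add: ExtIC_def)
  next
    case (insert t U)
    obtain d w s where t: "t = (d, w, s)" by (cases t)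
    have U: "valid_E n U" "d \<in> bits n" "w \<in> bits (2 * n)" "s \<in> bits (2 * n)"
      using insert.prems by (auto simp: valid_E_def t)
    have "(2 ^ (2 * n) - q) * card (ExtIC n k (insert t U)) \<le> (2 ^ (2 * n) - card U) * card (ExtIC n k (insert t U))"
      using insert by (intro mult_right_mono) auto
    also have "\<dots> \<le> card (ExtIC n k U)"
      using ExtIC_fresh[OF k U] insert.hyps unfolding t by blast
    finally have "(2 ^ (2 * n) - q) ^ card U * ((2 ^ (2 * n) - q) * card (ExtIC n k (insert t U)))
        \<le> (2 ^ (2 * n) - q) ^ card U * card (ExtIC n k U)"
      by (rule mult_left_mono) simp
    also have "\<dots> \<le> card (blockciphers n)" using insert U by (intro insert.IH) auto
    finally show ?case using insert.hyps by (simp add: mult_ac)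
  qed
qed

subsection \<open>The cipher\<close>

lemma bij_betw_xorb: "a \<in> bits n \<Longrightarrow> bij_betw (xorb a) (bits n) (bits n)"
  by (rule bij_betw_byWitness[where f' = "xorb a"]) (auto simp: xorb_cancel)

lemma bij_betw_Psi:
  assumes "kap \<in> bits n" "\<And>x. x \<in> bits n \<Longrightarrow> f x \<in> bits n"
  shows "bij_betw (Psi f kap) (bits n \<times> bits n) (bits n \<times> bits n)"
proof (rule bij_betw_byWitness[where f' = "\<lambda>(a, b). (xorb b (f (xorb kap a)), a)"])
  have f: "f (xorb kap b) \<in> bits n" if "b \<in> bits n" for b using assms that by simp
  have "xorb (xorb a (f (xorb kap b))) (f (xorb kap b)) = a" if "a \<in> bits n" "b \<in> bits n" for a b
    using that xorb_cancel[OF f[OF that(2)] that(1)] by (simp add: xorb_commute)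
  then show "\<forall>W\<in>bits n \<times> bits n. (\<lambda>(a, b). (xorb b (f (xorb kap a)), a)) (Psi f kap W) = W"
    "\<forall>W\<in>bits n \<times> bits n. Psi f kap ((\<lambda>(a, b). (xorb b (f (xorb kap a)), a)) W) = W"
    unfolding Psi_def by force+
  show "Psi f kap ` (bits n \<times> bits n) \<subseteq> bits n \<times> bits n"
    "(\<lambda>(a, b). (xorb b (f (xorb kap a)), a)) ` (bits n \<times> bits n) \<subseteq> bits n \<times> bits n"
    using f by (auto simp: Psi_def)
qed

lemma bij_betw_fold:
  "(\<And>j. j \<in> set js \<Longrightarrow> bij_betw (f j) A A) \<Longrightarrow> bij_betw (fold f js) A A"
  by (induction js) (auto intro: bij_betw_trans simp: bij_betw_id)

locale keyed_sched =
  fixes n :: nat and S :: sched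
  assumes affine: "affine_sched n S"
begin

lemma omg_bits [simp]: "i < 4 \<Longrightarrow> omg n S i k \<in> bits n"
  and gam_bits [simp]: "1 \<le> j \<Longrightarrow> j \<le> 6 \<Longrightarrow> gam n S j k \<in> bits n"
  using affine mv_bits by (auto simp: affine_sched_def omg_def gam_def bits_def)

lemma omg_xorb: "k \<in> bits n \<Longrightarrow> d \<in> bits n \<Longrightarrow> omg n S i (xorb k d) = xorb (omg n S i k) (mv n (Mw S i) d)"
  and gam_xorb: "k \<in> bits n \<Longrightarrow> d \<in> bits n \<Longrightarrow> gam n S j (xorb k d) = xorb (gam n S j k) (mv n (Mg S j) d)"
  by (simp_all add: omg_def gam_def mv_xorb xorb_ac)

lemma bij_betw_KAFw:
  assumes "P permutes bits n"
  shows "bij_betw (KAFw n S P k) (bits (2 * n)) (bits (2 * n))"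
proof -
  let ?B = "bits n \<times> bits n"
  have split: "bij_betw (\<lambda>W. (take n W, drop n W)) (bits (2 * n)) ?B"
    by (rule bij_betw_byWitness[where f' = "\<lambda>(a, b). a @ b"]) (auto simp: bits_def)
  have glue: "bij_betw (\<lambda>(a, b). a @ b) ?B (bits (2 * n))"
    by (rule bij_betw_byWitness[where f' = "\<lambda>W. (take n W, drop n W)"]) (auto simp: bits_def)
  have whiten: "bij_betw (map_prod (xorb a) (xorb b)) ?B ?B" if "a \<in> bits n" "b \<in> bits n" for a b
    using that by (intro bij_betw_map_prod bij_betw_xorb)
  have "bij_betw (fold (\<lambda>j Z. Psi P (gam n S j k) Z) [1..<7]) ?B ?B"
    using assms by (intro bij_betw_fold bij_betw_Psi) (auto simp: permutes_in_image)
  from bij_betw_trans[OF bij_betw_trans[OF bij_betw_trans[OF bij_betw_trans[OF split whiten] this] whiten] glue]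
  have "bij_betw ((\<lambda>(a, b). a @ b) \<circ> (map_prod (xorb (omg n S 2 k)) (xorb (omg n S 3 k)) \<circ>
      (fold (\<lambda>j Z. Psi P (gam n S j k) Z) [1..<7] \<circ>
      (map_prod (xorb (omg n S 0 k)) (xorb (omg n S 1 k)) \<circ> (\<lambda>W. (take n W, drop n W))))))
    (bits (2 * n)) (bits (2 * n))" by simp
  then show ?thesis
    by (rule bij_betw_cong[THEN iffD1, rotated]) (simp add: KAFw_def Let_def case_prod_unfold)
qed

text \<open>A half-index (t, b) names one end of the cipher on the triple t = (d, w, s): the first rounds for
  b = False and, read backwards, the last rounds for b = True.\<close>

fun hX hA hA' hC :: "bool list \<Rightarrow> (bool list \<times> bool list \<times> bool list) \<times> bool \<Rightarrow> bool list" where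
  "hX k ((d, w, s), b) = (let k' = xorb k d in
     if b then xorb (xorb (omg n S 2 k') (gam n S 6 k')) (take n s)
     else xorb (xorb (omg n S 1 k') (gam n S 1 k')) (drop n w))"
| "hA k ((d, w, s), b) = (let k' = xorb k d in
     if b then xorb (xorb (omg n S 3 k') (gam n S 5 k')) (drop n s)
     else xorb (xorb (omg n S 0 k') (gam n S 2 k')) (take n w))"
| "hA' k ((d, w, s), b) = (let k' = xorb k d in
     if b then xorb (xorb (omg n S 2 k') (gam n S 4 k')) (take n s)
     else xorb (xorb (omg n S 1 k') (gam n S 3 k')) (drop n w))"
| "hC k ((d, w, s), b) = (let k' = xorb k d in
     if b then xorb (xorb (omg n S 1 k') (gam n S 5 k')) (drop n w)
     else xorb (xorb (omg n S 2 k') (gam n S 2 k')) (take n s))"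

definition hX2 :: "(bool list \<Rightarrow> bool list) \<Rightarrow> bool list \<Rightarrow> (bool list \<times> bool list \<times> bool list) \<times> bool \<Rightarrow> bool list" where
  "hX2 P k h = xorb (hA k h) (P (hX k h))"

lemma half_bits:
  assumes "k \<in> bits n" "d \<in> bits n" "w \<in> bits (2 * n)" "s \<in> bits (2 * n)"
  shows "hX k ((d, w, s), b) \<in> bits n" "hA k ((d, w, s), b) \<in> bits n"
    "hA' k ((d, w, s), b) \<in> bits n" "hC k ((d, w, s), b) \<in> bits n"
proof -
  have "take n w \<in> bits n" "drop n w \<in> bits n" "take n s \<in> bits n" "drop n s \<in> bits n"
    using assms by (auto simp: bits_def)
  then show "hX k ((d, w, s), b) \<in> bits n" "hA k ((d, w, s), b) \<in> bits n"
    "hA' k ((d, w, s), b) \<in> bits n" "hC k ((d, w, s), b) \<in> bits n"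
    by (simp_all add: Let_def)
qed

text \<open>The equation for the half-index b prescribes the output of round 3 (b = False) or round 4 (b = True)
  that makes the two ends meet.\<close>

lemma KAFw_meet_in_the_middle:
  assumes P: "P permutes bits n" and k: "k \<in> bits n" and d: "d \<in> bits n"
    and w: "w \<in> bits (2 * n)" and s: "s \<in> bits (2 * n)"
    and mid: "\<And>b. P (xorb (hA' k ((d, w, s), b)) (P (hX2 P k ((d, w, s), b)))) =
      xorb (xorb (hC k ((d, w, s), b)) (hX2 P k ((d, w, s), b))) (P (hX2 P k ((d, w, s), \<not> b)))"
  shows "KAFw n S P (xorb k d) w = s"
proof -
  define k' where "k' = xorb k d"
  define o0 o1 o2 o3 where o: "o0 = omg n S 0 k'" "o1 = omg n S 1 k'" "o2 = omg n S 2 k'" "o3 = omg n S 3 k'"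
  define g1 g2 g3 g4 g5 g6 where g: "g1 = gam n S 1 k'" "g2 = gam n S 2 k'" "g3 = gam n S 3 k'"
    "g4 = gam n S 4 k'" "g5 = gam n S 5 k'" "g6 = gam n S 6 k'"
  define wl wr sl sr where ws: "wl = take n w" "wr = drop n w" "sl = take n s" "sr = drop n s"
  have len: "length o0 = n" "length o1 = n" "length o2 = n" "length o3 = n"
    "length g1 = n" "length g2 = n" "length g3 = n" "length g4 = n" "length g5 = n" "length g6 = n"
    "length wl = n" "length wr = n" "length sl = n" "length sr = n"
    using omg_bits gam_bits w s by (simp_all add: o g ws bits_def)
  have lenP: "length x = n \<Longrightarrow> length (P x) = n" for x
    using permutes_in_image[OF P, of x] by (simp add: bits_def)
  \<comment> \<open>The six inputs of P: \<open>x1\<close>, \<open>x2\<close>, \<open>x3\<close> are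
    computed forwards from \<open>w\<close>, while \<open>x6\<close>, \<open>x5\<close>,
    \<open>x4\<close> are computed backwards from \<open>s\<close>.\<close>
  define x1 where "x1 = xorb (xorb o1 g1) wr"
  define x6 where "x6 = xorb (xorb o2 g6) sl"
  define x2 where "x2 = xorb (xorb (xorb o0 g2) wl) (P x1)"
  define x5 where "x5 = xorb (xorb (xorb o3 g5) sr) (P x6)"
  define x3 where "x3 = xorb (xorb (xorb o1 g3) wr) (P x2)"
  define x4 where "x4 = xorb (xorb (xorb o2 g4) sl) (P x5)"
  note x = x1_def x2_def x3_def x4_def x5_def x6_def
  have lenx: "length x1 = n" "length x2 = n" "length x3 = n" "length x4 = n" "length x5 = n" "length x6 = n"
    using len lenP by (simp_all add: x)
  \<comment> \<open>Going down, the state word after round 3 is \<open>z2\<close> plus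
    \<open>P x3\<close>, where \<open>z2\<close> is \<open>x2\<close> plus \<open>g2\<close>; going
    up it is \<open>o2\<close> plus \<open>sl\<close> plus \<open>P x5\<close>. Solving for
    \<open>P x3\<close> gives this equation and explains the words collected in \<open>hC\<close>.
    \<open>P4\<close> arises in the same way from the state word after round 4.\<close>
  have P3: "P x3 = xorb (xorb (xorb (xorb o2 g2) sl) x2) (P x5)"
    using mid[of False] by (simp add: hX2_def Let_def k'_def[symmetric] o[symmetric] g[symmetric] ws[symmetric] x del: One_nat_def)
  have P4: "P x4 = xorb (xorb (xorb (xorb o1 g5) wr) x5) (P x2)"
    using mid[of True] by (simp add: hX2_def Let_def k'_def[symmetric] o[symmetric] g[symmetric] ws[symmetric] x del: One_nat_def)
  \<comment> \<open>The state words of the forward computation: round i turns the pair of words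
    numbered i-1 and i into the pair numbered i and i+1.\<close>
  define z0 z1 z2 z3 where z0123: "z0 = xorb o0 wl" "z1 = xorb o1 wr" "z2 = xorb z0 (P x1)" "z3 = xorb z1 (P x2)"
  define z4 z5 z6 z7 where z4567: "z4 = xorb z2 (P x3)" "z5 = xorb z3 (P x4)" "z6 = xorb z4 (P x5)" "z7 = xorb z5 (P x6)"
  note z = z0123 z4567
  have lenPx: "length (P x1) = n" "length (P x2) = n" "length (P x5) = n" "length (P x6) = n"
    using lenx lenP by simp_all
  note lens = len lenx lenPx
  have a1: "xorb g1 z1 = x1" and a2: "xorb g2 z2 = x2" and a3: "xorb g3 z3 = x3"
    by (simp_all add: z x xorb_ac)
  have z4: "z4 = xorb (xorb o2 sl) (P x5)"
    unfolding z P3 by (rule nth_equalityI) (use lens in \<open>auto simp: x2_def\<close>)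
  have z5: "z5 = xorb g5 x5"
    unfolding z P4 by (rule nth_equalityI) (use lens in auto)
  have z6: "z6 = xorb o2 sl"
    unfolding z4567(3) z4 by (rule nth_equalityI) (use lens in auto)
  have z7: "z7 = xorb o3 sr"
    unfolding z4567(4) z5 x5_def by (rule nth_equalityI) (use lens in auto)
  have a4: "xorb g4 z4 = x4" by (simp add: z4 x4_def xorb_ac)
  have a5: "xorb g5 z5 = x5" unfolding z5 by (rule nth_equalityI) (use lens in auto)
  have a6: "xorb g6 z6 = x6" by (simp add: z6 x6_def xorb_ac)
  have rounds: "[1..<7] = [1, 2, 3, 4, 5, 6::nat]" by (simp add: upt_rec)
  have "fold (\<lambda>j Z. Psi P (gam n S j k') Z) [1..<7] (z0, z1) = (z6, z7)"
    unfolding rounds fold.simps comp_def id_def Psi_def fst_conv snd_conv g[symmetric]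
      a1 z0123(3)[symmetric] a2 z0123(4)[symmetric] a3 z4567(1)[symmetric] a4 z4567(2)[symmetric]
      a5 z4567(3)[symmetric] a6 z4567(4)[symmetric] by (rule refl)
  then have "KAFw n S P k' w = xorb o2 z6 @ xorb o3 z7"
    by (simp add: KAFw_def o g ws z0123(1,2))
  also have "xorb o2 z6 = sl" unfolding z6 by (rule nth_equalityI) (use lens in auto)
  also have "xorb o3 z7 = sr" unfolding z7 by (rule nth_equalityI) (use lens in auto)
  finally show ?thesis by (simp add: k'_def ws)
qed

end

subsection \<open>Good key schedules\<close>

lemma rare_at_most_one:
  assumes "finite \<Omega>" "\<Omega> \<noteq> {}" "\<And>x y. x \<in> \<Omega> \<Longrightarrow> y \<in> \<Omega> \<Longrightarrow> E x \<Longrightarrow> E y \<Longrightarrow> x = y"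
  shows "rare \<Omega> E (1 / card \<Omega>)"
proof -
  have "card {\<omega> \<in> \<Omega>. E \<omega>} \<le> Suc 0"
    using assms by (subst card_le_Suc0_iff_eq) auto
  moreover have "card \<Omega> > 0" using assms by (simp add: card_gt_0_iff)
  ultimately show ?thesis by (simp add: rare_def)
qed

locale good_keyed_sched = keyed_sched +
  assumes good: "good_sched n S"
begin

definition \<phi> :: "bool \<Rightarrow> bool list \<Rightarrow> bool list" where
  "\<phi> b k = (if b then xorb (omg n S 2 k) (gam n S 6 k) else xorb (omg n S 1 k) (gam n S 1 k))"

definition lin :: "bool \<Rightarrow> bool list \<Rightarrow> bool list" where
  "lin b k = (if b then xorb (mv n (Mw S 2) k) (mv n (Mg S 6) k) else xorb (mv n (Mw S 1) k) (mv n (Mg S 1) k))"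

lemma \<phi>_bits [simp]: "\<phi> b k \<in> bits n"
  by (simp add: \<phi>_def)

lemma lin_bits [simp]: "lin b k \<in> bits n"
  by (simp add: lin_def)

lemma \<phi>_inj: "k \<in> bits n \<Longrightarrow> k' \<in> bits n \<Longrightarrow> \<phi> b k = \<phi> b k' \<Longrightarrow> k = k'"
  using good by (cases b) (auto simp: good_sched_def Let_def \<phi>_def bij_betw_def dest: inj_onD)

lemma \<phi>_sum_inj:
  "k \<in> bits n \<Longrightarrow> k' \<in> bits n \<Longrightarrow> xorb (\<phi> False k) (\<phi> True k) = xorb (\<phi> False k') (\<phi> True k') \<Longrightarrow> k = k'"
  using good by (auto simp: good_sched_def Let_def \<phi>_def bij_betw_def dest: inj_onD)

lemma \<phi>_xorb: "k \<in> bits n \<Longrightarrow> d \<in> bits n \<Longrightarrow> \<phi> b (xorb k d) = xorb (\<phi> b k) (lin b d)"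
  by (cases b) (simp_all only: \<phi>_def lin_def if_True if_False omg_xorb gam_xorb, simp_all only: xorb_ac)

lemma hX_\<phi>: "hX k ((d, w, s), b) = xorb (\<phi> b (xorb k d)) (if b then take n s else drop n w)"
  by (simp add: \<phi>_def Let_def)

lemma valid_E_D:
  assumes "valid_E n U" "(d, w, s) \<in> U"
  shows "d \<in> bits n" "w \<in> bits (2 * n)" "s \<in> bits (2 * n)"
  using assms by (auto simp: valid_E_def)

lemma hX_bits:
  "valid_E n U \<Longrightarrow> t \<in> U \<Longrightarrow> k \<in> bits n \<Longrightarrow> hX k (t, b) \<in> bits n"
  by (cases t) (blast intro: half_bits(1) dest: valid_E_D)

text \<open>Since the schedule is affine, the key acts on all outermost inputs of one end as the
  common mask \<open>lin b k\<close>; whether two of them agree is visible without the key.\<close>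

lemma hX_shift:
  assumes "valid_E n U" "t \<in> U" "k \<in> bits n"
  shows "hX k (t, b) = xorb (lin b k) (hX (zeros n) (t, b))"
proof -
  obtain d w s where t: "t = (d, w, s)" by (cases t)
  have d: "d \<in> bits n" using assms valid_E_D t by blast
  have "\<phi> b (xorb k d) = xorb (lin b k) (\<phi> b d)"
    using \<phi>_xorb[OF d assms(3)] by (simp add: xorb_commute)
  then show ?thesis by (simp only: t hX_\<phi> xorb_zeros[OF d] xorb_assoc)
qed

lemma hX_eq_iff:
  assumes "valid_E n U" "t \<in> U" "t' \<in> U" "k \<in> bits n"
  shows "hX k (t, b) = hX k (t', b) \<longleftrightarrow> hX (zeros n) (t, b) = hX (zeros n) (t', b)"
  unfolding hX_shift[OF assms(1,2,4)] hX_shift[OF assms(1,3,4)]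
  by (rule xorb_inject) (auto intro: hX_bits assms)

text \<open>By \<open>hX_eq_iff\<close> the zero key represents every key. This keeps the event a
  property of the transcript alone, so it can be bounded in the ideal world.\<close>

definition coll :: "epairs \<Rightarrow> bool" where
  "coll U \<longleftrightarrow> (\<exists>t\<in>U. \<exists>t'\<in>U. t \<noteq> t' \<and> (\<forall>b. hX (zeros n) (t, b) = hX (zeros n) (t', b)))"

definition bad_key :: "ppairs \<Rightarrow> epairs \<Rightarrow> bool list \<Rightarrow> bool" where
  "bad_key Q U k \<longleftrightarrow> (\<exists>h\<in>U \<times> UNIV. \<exists>x\<in>fst ` Q. hX k h = x)
     \<or> (\<exists>t\<in>U. \<exists>t'\<in>U. hX k (t, False) = hX k (t', True))"

text \<open>Each coincidence happens for at most one key: meeting a known point determines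
  \<open>\<phi>\<close> at one end, and equality across the ends determines the sum of both
  \<open>\<phi>\<close>. There are at most 2uq coincidences of the first kind and u^2 of the
  second.\<close>

lemma rare_bad_key:
  assumes Q: "valid_P n Q" and U: "valid_E n U"
  shows "rare (bits n) (bad_key Q U) ((2 * card U * card Q + (card U)\<^sup>2) / 2 ^ n)"
proof -
  have finQ: "finite Q" and finU: "finite U" using Q U by (simp_all add: valid_P_def valid_E_def)
  let ?c = "1 / 2 ^ n :: real"
  have c: "?c = 1 / card (bits n)" by (simp add: card_bits)
  have single: "rare (bits n) (\<lambda>k. hX k h = x) ?c" if h: "h \<in> U \<times> UNIV" for h x
    unfolding c
  proof (rule rare_at_most_one)
    fix k k' assume k: "k \<in> bits n" "k' \<in> bits n" "hX k h = x" "hX k' h = x"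
    obtain t b where h: "h = (t, b)" "t \<in> U" using h by auto
    obtain d w s where t: "t = (d, w, s)" by (cases t)
    have d: "d \<in> bits n" "w \<in> bits (2 * n)" "s \<in> bits (2 * n)" using valid_E_D[OF U] h t by blast+
    let ?y = "if b then take n s else drop n w"
    have y: "?y \<in> bits n" using d by (auto simp: bits_def)
    have "xorb ?y (\<phi> b (xorb k d)) = xorb ?y (\<phi> b (xorb k' d))"
      using k(3,4) unfolding h t hX_\<phi> by (simp only: xorb_commute)
    then have "\<phi> b (xorb k d) = \<phi> b (xorb k' d)" using xorb_inject y \<phi>_bits by blast
    then have "xorb k d = xorb k' d" using \<phi>_inj k d by simp
    then show "k = k'" using xorb_inject[OF d(1) k(1,2)] by (simp add: xorb_commute)
  qed auto
  have pair: "rare (bits n) (\<lambda>k. hX k (t, False) = hX k (t', True)) ?c" if t: "t \<in> U" "t' \<in> U" for t t'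
    unfolding c
  proof (rule rare_at_most_one)
    fix k k' assume k: "k \<in> bits n" "k' \<in> bits n"
      "hX k (t, False) = hX k (t', True)" "hX k' (t, False) = hX k' (t', True)"
    let ?a = "hX (zeros n) (t, False)" and ?b = "hX (zeros n) (t', True)" and ?z = "zeros n"
    have ab: "?a \<in> bits n" "?b \<in> bits n" using hX_bits[OF U] t by auto
    \<comment> \<open>The key enters the two inputs only through the masks of the two ends, so their
      equality fixes the sum of the masks.\<close>
    have lin_sum: "xorb (lin False k) (lin True k) = xorb ?a ?b"
      if k: "k \<in> bits n" "hX k (t, False) = hX k (t', True)" for k
    proof -
      have eq: "xorb (lin False k) ?a = xorb (lin True k) ?b"
        using k(2) unfolding hX_shift[OF U t(1) k(1)] hX_shift[OF U t(2) k(1)] .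
      show ?thesis
      proof (rule bits_eqI[of _ n])
        fix i assume i: "i < n"
        have "length (lin b k) = n" for b using lin_bits[of b k] unfolding bits_def by simp
        moreover have "xorb (lin False k) ?a ! i = xorb (lin True k) ?b ! i" using eq by simp
        moreover have "length ?a = n" "length ?b = n" using ab by (simp_all only: bits_def mem_Collect_eq)
        ultimately show "xorb (lin False k) (lin True k) ! i = xorb ?a ?b ! i"
          using i by (auto simp del: hX.simps)
      qed (use ab in \<open>auto simp del: hX.simps\<close>)
    qed
    have e: "xorb (\<phi> False k) (\<phi> True k) =
        xorb (xorb (\<phi> False ?z) (\<phi> True ?z)) (xorb (lin False k) (lin True k))" if "k \<in> bits n" for k
    proof -
      have "\<phi> b k = xorb (\<phi> b ?z) (lin b k)" for b
        using \<phi>_xorb[OF zeros_bits that] xorb_zeros[OF that] by simp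
      then show ?thesis by (simp only: xorb_ac)
    qed
    have "xorb (\<phi> False k) (\<phi> True k) = xorb (\<phi> False k') (\<phi> True k')"
      unfolding e[OF k(1)] e[OF k(2)] lin_sum[OF k(1,3)] lin_sum[OF k(2,4)] ..
    then show "k = k'" using \<phi>_sum_inj k by blast
  qed auto
  have "rare (bits n) (bad_key Q U) (card (U \<times> (UNIV :: bool set)) * card (fst ` Q) * ?c + card U * card U * ?c)"
    unfolding bad_key_def by (intro rare_disj rare_ex2) (use finQ finU single pair in auto)
  then show ?thesis
  proof (rule rare_mono)
    have "card (U \<times> (UNIV :: bool set)) = 2 * card U" by (simp add: card_cartesian_product)
    moreover have "card U * card (fst ` Q) \<le> card U * card Q" using card_image_le[OF finQ, of fst] by simp
    ultimately have "real (card (U \<times> (UNIV :: bool set)) * card (fst ` Q) + card U * card U)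
      \<le> real (2 * card U * card Q + (card U)\<^sup>2)" unfolding of_nat_le_iff by (simp add: power2_eq_square)
    then show "card (U \<times> (UNIV :: bool set)) * card (fst ` Q) * ?c + card U * card U * ?c
      \<le> (2 * card U * card Q + (card U)\<^sup>2) / 2 ^ n"
      by (simp add: divide_right_mono add_divide_distrib[symmetric])
  qed auto
qed

text \<open>Under equal offsets, equal \<open>hX\<close> and \<open>hA\<close> give both halves of
  the plaintext or of the ciphertext, hence the whole triple. Under different offsets,
  \<open>hX\<close> and \<open>hA'\<close> carry the same whitening key and data word and differ
  only in the round key. Their sum leaves two round keys, and agreement there contradicts condition
  (2) for the difference of the offsets.\<close>

lemma half_separated:
  assumes U: "valid_E n U" and k: "k \<in> bits n"
    and fn: "\<And>d w s s'. (d, w, s) \<in> U \<Longrightarrow> (d, w, s') \<in> U \<Longrightarrow> s = s'"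
    and inj: "\<And>d w w' s. (d, w, s) \<in> U \<Longrightarrow> (d, w', s) \<in> U \<Longrightarrow> w = w'"
    and t: "t \<in> U" "t' \<in> U" "t \<noteq> t'"
    and X: "hX k (t, b) = hX k (t', b)" and A: "hA k (t, b) = hA k (t', b)"
  shows "hA' k (t, b) \<noteq> hA' k (t', b)"
proof
  assume A': "hA' k (t, b) = hA' k (t', b)"
  obtain d w s d' w' s' where tt: "t = (d, w, s)" "t' = (d', w', s')" by (cases t, cases t')
  note b = valid_E_D[OF U, of d w s] valid_E_D[OF U, of d' w' s'] t tt
  have dw: "d \<in> bits n" "d' \<in> bits n" "length w = 2 * n" "length w' = 2 * n" "length s = 2 * n" "length s' = 2 * n"
    using b by (auto simp: bits_def)
  have half: "take n w \<in> bits n" "drop n w \<in> bits n" "take n s \<in> bits n" "drop n s \<in> bits n"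
    "take n w' \<in> bits n" "drop n w' \<in> bits n" "take n s' \<in> bits n" "drop n s' \<in> bits n"
    using dw by (auto simp: bits_def)
  let ?k = "xorb k d" and ?k' = "xorb k d'"
  show False
  proof (cases "d = d'")
    case True
    show False
    proof (cases b)
      case b: True
      have "take n s = take n s'" "drop n s = drop n s'"
        using X A b True half k dw by (simp_all add: tt Let_def xorb_inject[of _ n])
      then have "s = s'" by (metis append_take_drop_id)
      then show False using inj t tt True by blast
    next
      case b: False
      have "drop n w = drop n w'" "take n w = take n w'"
        using X A b True half k dw by (simp_all add: tt Let_def xorb_inject[of _ n] del: One_nat_def)
      then have "w = w'" by (metis append_take_drop_id)
      then show False using fn t tt True by blast
    qed
  next
    case False
    let ?d = "xorb d d'"
    have d: "?d \<in> bits n" "?d \<noteq> zeros n"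
    proof -
      show "?d \<in> bits n" using dw by simp
      show "?d \<noteq> zeros n"
        using False xorb_inject[of d n d' d] xorb_self[of d n] dw by auto
    qed
    \<comment> \<open>Eliminates the whitening key and the data word that both equations
      share.\<close>
    have cancel: "xorb g1 g3 = xorb g1' g3'"
      if "xorb (xorb o1 g1) r = xorb (xorb o1' g1') r'" "xorb (xorb o1 g3) r = xorb (xorb o1' g3') r'"
        and l: "o1 \<in> bits n" "o1' \<in> bits n" "g1 \<in> bits n" "g1' \<in> bits n" "g3 \<in> bits n" "g3' \<in> bits n"
          "r \<in> bits n" "r' \<in> bits n" for o1 o1' g1 g1' g3 g3' r r'
    proof (rule bits_eqI)
      fix i assume i: "i < n"
      have "xorb (xorb o1 g1) r ! i = xorb (xorb o1' g1') r' ! i"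
        "xorb (xorb o1 g3) r ! i = xorb (xorb o1' g3') r' ! i" using that(1,2) by simp_all
      then show "xorb g1 g3 ! i = xorb g1' g3' ! i" using l i by (auto simp: bits_def)
    qed (use l in auto)
    have diff: "mv n (Mg S i) ?d = mv n (Mg S j) ?d"
      if eq: "xorb (gam n S i ?k) (gam n S j ?k) = xorb (gam n S i ?k') (gam n S j ?k')"
        and ij: "1 \<le> i" "i \<le> 6" "1 \<le> j" "j \<le> 6" for i j
    proof -
      have "xorb (xorb (gam n S i k) (gam n S j k)) (xorb (mv n (Mg S i) d) (mv n (Mg S j) d)) =
        xorb (xorb (gam n S i k) (gam n S j k)) (xorb (mv n (Mg S i) d') (mv n (Mg S j) d'))"
        using eq unfolding gam_xorb[OF k dw(1)] gam_xorb[OF k dw(2)] by (simp only: xorb_ac)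
      then have eq': "xorb (mv n (Mg S i) d) (mv n (Mg S j) d) = xorb (mv n (Mg S i) d') (mv n (Mg S j) d')"
        using ij by (simp add: xorb_inject[of _ n])
      show ?thesis unfolding mv_xorb[OF dw(1,2)]
      proof (rule bits_eqI[of _ n])
        fix l assume l: "l < n"
        have "length (mv n M x) = n" for M x by (simp add: mv_def)
        moreover have "xorb (mv n (Mg S i) d) (mv n (Mg S j) d) ! l = xorb (mv n (Mg S i) d') (mv n (Mg S j) d') ! l"
          using eq' by simp
        ultimately show "xorb (mv n (Mg S i) d) (mv n (Mg S i) d') ! l = xorb (mv n (Mg S j) d) (mv n (Mg S j) d') ! l"
          using l by auto
      qed auto
    qed
    show False
    proof (cases b)
      case True
      have "xorb (gam n S 6 ?k) (gam n S 4 ?k) = xorb (gam n S 6 ?k') (gam n S 4 ?k')"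
        by (rule cancel[of "omg n S 2 ?k" _ "take n s" "omg n S 2 ?k'" _ "take n s'"])
          (use X A' True half in \<open>simp_all add: tt Let_def\<close>)
      then have "mv n (Mg S 6) ?d = mv n (Mg S 4) ?d" by (rule diff) auto
      then show False using good d by (auto simp: good_sched_def)
    next
      case b: False
      have "xorb (gam n S 1 ?k) (gam n S 3 ?k) = xorb (gam n S 1 ?k') (gam n S 3 ?k')"
        by (rule cancel[of "omg n S 1 ?k" _ "drop n w" "omg n S 1 ?k'" _ "drop n w'"])
          (use X A' b half in \<open>simp_all add: tt Let_def del: One_nat_def\<close>)
      then have "mv n (Mg S 1) ?d = mv n (Mg S 3) ?d" by (rule diff) auto
      then show False using good d by (auto simp: good_sched_def)
    qed
  qed
qed

text \<open>\<open>first_layer\<close> with m = 2u ends and q known points of P, where 4/3 (6uq +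
  36u^2 + 2u) = 8uq + 48u^2 + 8u/3. The involution negates the Boolean of the half-index.\<close>

lemma KAFw_count:
  assumes Q: "valid_P n Q" and U: "valid_E n U" and k: "k \<in> bits n"
    and fn: "\<And>d w s s'. (d, w, s) \<in> U \<Longrightarrow> (d, w, s') \<in> U \<Longrightarrow> s = s'"
    and inj: "\<And>d w w' s. (d, w, s) \<in> U \<Longrightarrow> (d, w', s) \<in> U \<Longrightarrow> w = w'"
    and nc: "\<not> coll U" and gk: "\<not> bad_key Q U k"
    and small: "U \<noteq> {} \<Longrightarrow> 4 * (card Q + 2 * card U + 1) \<le> 2 ^ n"
  shows "(1 - (8 * card U * card Q + 48 * (card U)\<^sup>2 + 8 / 3 * card U) / 2 ^ n) * card (Ext n Q)
    \<le> (2 ^ n) ^ (2 * card U) * card {P \<in> Ext n Q. \<forall>(d, w, s)\<in>U. KAFw n S P (xorb k d) w = s}"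
proof -
  let ?H = "U \<times> (UNIV :: bool set)" and ?st = "\<lambda>(t, b). (t, \<not> b)"
  have cH: "card ?H = 2 * card U" by (simp add: card_cartesian_product)
  have coeff: "4 / (3 * 2 ^ n) * real (3 * card ?H * card Q + 9 * (card ?H)\<^sup>2 + card ?H) =
      (8 * card U * card Q + 48 * (card U)\<^sup>2 + 8 / 3 * card U) / 2 ^ n"
    unfolding cH by (simp add: field_simps power2_eq_square)
  have finU: "finite U" using U by (simp add: valid_E_def)
  have hb: "hX k (t, b) \<in> bits n" "hA k (t, b) \<in> bits n" "hA' k (t, b) \<in> bits n" "hC k (t, b) \<in> bits n"
    if "t \<in> U" for t b
  proof -
    obtain d w s where t: "t = (d, w, s)" by (cases t)
    note b = half_bits[where b = b, OF k valid_E_D[OF U that[unfolded t]], folded t]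
    show "hX k (t, b) \<in> bits n" "hA k (t, b) \<in> bits n" "hA' k (t, b) \<in> bits n" "hC k (t, b) \<in> bits n"
      by (rule b)+
  qed
  \<comment> \<open>For a good key no round 1 input equals a round 6 input, so ends with equal
    outermost inputs are of the same kind.\<close>
  have same_side: "b = b'" if "t \<in> U" "t' \<in> U" "hX k (t, b) = hX k (t', b')" for t t' b b'
    using that gk unfolding bad_key_def by (cases b; cases b') (auto; metis)+
  let ?meet = "\<lambda>P. \<forall>h\<in>?H. P (xorb (hA' k h) (P (xorb (hA k h) (P (hX k h))))) =
    xorb (xorb (hC k h) (xorb (hA k h) (P (hX k h)))) (P (xorb (hA k (?st h)) (P (hX k (?st h)))))"
  have "(1 - 4 / (3 * 2 ^ n) * (3 * card ?H * card Q + 9 * (card ?H)\<^sup>2 + card ?H)) * card (Ext n Q)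
    \<le> (2 ^ n) ^ card ?H * card {P \<in> Ext n Q. ?meet P}"
  proof (rule first_layer)
    show "finite ?H" "finite Q" using finU Q by (simp_all add: valid_P_def)
    show "4 * (card Q + card ?H + 1) \<le> 2 ^ n" if "?H \<noteq> {}"
      using small that unfolding cH by auto
    fix h assume h: "h \<in> ?H"
    show "?st h \<in> ?H" using h by auto
    show "hX k h \<in> bits n" "hA k h \<in> bits n" "hA' k h \<in> bits n" "hC k h \<in> bits n" using h hb by auto
    show "hX k h \<notin> fst ` Q" using h gk unfolding bad_key_def by blast
    fix h' assume h': "h' \<in> ?H" and ne: "h \<noteq> h'"
    obtain t b t' b' where hh: "h = (t, b)" "h' = (t', b')" by (cases h, cases h')
    have t: "t \<in> U" "t' \<in> U" using h h' hh by auto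
    show "hA' k h \<noteq> hA' k h'" if "hX k h = hX k h'" "hA k h = hA k h'"
    proof -
      have b: "b = b'" using same_side[OF t] that(1) hh by simp
      then have ne': "t \<noteq> t'" using ne hh by simp
      have eqs: "hX k (t, b) = hX k (t', b)" "hA k (t, b) = hA k (t', b)" using that unfolding hh b by auto
      have "hA' k (t, b) \<noteq> hA' k (t', b)"
        by (rule half_separated[OF U k]) (fact fn inj t ne' eqs)+
      then show ?thesis unfolding hh b .
    qed
    show "hX k h \<noteq> hX k h'" if "hX k (?st h) = hX k (?st h')"
    proof
      \<comment> \<open>Agreement here together with agreement of the opposite ends is a two-sided
        collision.\<close>
      assume eq: "hX k h = hX k h'"
      have b: "b = b'" using same_side[OF t] eq hh by simp
      then have "t \<noteq> t'" using ne hh by simp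
      moreover have "hX k (t, c) = hX k (t', c)" for c
        using eq that hh b by (cases "c = b") auto
      ultimately show False using nc t hX_eq_iff[OF U t k] unfolding coll_def by blast
    qed
  qed
  also have "\<dots> \<le> real ((2 ^ n) ^ card ?H * card {P \<in> Ext n Q. \<forall>(d, w, s)\<in>U. KAFw n S P (xorb k d) w = s})"
    unfolding of_nat_le_iff
  proof (intro mult_left_mono card_mono)
    show "{P \<in> Ext n Q. ?meet P}
      \<subseteq> {P \<in> Ext n Q. \<forall>(d, w, s)\<in>U. KAFw n S P (xorb k d) w = s}"
    proof (intro subsetI CollectI conjI ballI)
      fix P t assume P: "P \<in> {P \<in> Ext n Q. ?meet P}"
        and t: "t \<in> U"
      obtain d w s where tt: "t = (d, w, s)" by (cases t)
      have "KAFw n S P (xorb k d) w = s"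
      proof (rule KAFw_meet_in_the_middle[OF _ k])
        show "P permutes bits n" using P by (simp add: Ext_def)
        show "d \<in> bits n" "w \<in> bits (2 * n)" "s \<in> bits (2 * n)" using valid_E_D[OF U] t tt by blast+
        fix b
        have "(t, b) \<in> ?H" using t by simp
        with P have "P (xorb (hA' k (t, b)) (P (xorb (hA k (t, b)) (P (hX k (t, b)))))) =
          xorb (xorb (hC k (t, b)) (xorb (hA k (t, b)) (P (hX k (t, b))))) (P (xorb (hA k (?st (t, b))) (P (hX k (?st (t, b))))))"
          by blast
        then show "P (xorb (hA' k ((d, w, s), b)) (P (hX2 P k ((d, w, s), b)))) =
          xorb (xorb (hC k ((d, w, s), b)) (hX2 P k ((d, w, s), b))) (P (hX2 P k ((d, w, s), \<not> b)))"
          unfolding hX2_def tt prod.case .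
      qed
      then show "case t of (d, w, s) \<Rightarrow> KAFw n S P (xorb k d) w = s" by (simp add: tt)
    qed auto
  qed simp_all
  finally show ?thesis unfolding coeff by (simp only: cH)
qed

end

subsection \<open>The two worlds\<close>

lemma perms_Ext: "perms n = Ext n {}"
  by (simp add: perms_def Ext_def)

lemma finite_perms [simp]: "finite (perms n)"
  by (simp add: perms_Ext)

lemma perms_nonempty: "perms n \<noteq> {}"
proof -
  have "id \<in> perms n" by (simp add: perms_def permutes_id)
  then show ?thesis by blast
qed

lemma answer_shift: "answer n P (\<lambda>d. E (xorb k d)) (zeros n) = answer n P E k"
  by (rule ext, rename_tac q, case_tac q) (auto simp: answer_def xorb_zeros)

lemma card_half_fixed:
  "card {r \<in> bits (2 * n). take n r = v} \<le> 2 ^ n" "card {r \<in> bits (2 * n). drop n r = v} \<le> 2 ^ n"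
proof -
  have "card {r \<in> bits (2 * n). take n r = v} \<le> card (bits n)"
  proof (rule card_inj_on_le[of "drop n"])
    show "inj_on (drop n) {r \<in> bits (2 * n). take n r = v}"
      by (rule inj_onI) (metis (mono_tags, lifting) append_take_drop_id mem_Collect_eq)
    show "drop n ` {r \<in> bits (2 * n). take n r = v} \<subseteq> bits n" by (auto simp: bits_def)
  qed simp
  then show "card {r \<in> bits (2 * n). take n r = v} \<le> 2 ^ n" by (simp add: card_bits)
  have "card {r \<in> bits (2 * n). drop n r = v} \<le> card (bits n)"
  proof (rule card_inj_on_le[of "take n"])
    show "inj_on (take n) {r \<in> bits (2 * n). drop n r = v}"
      by (rule inj_onI) (metis (mono_tags, lifting) append_take_drop_id mem_Collect_eq)
    show "take n ` {r \<in> bits (2 * n). drop n r = v} \<subseteq> bits n" by (auto simp: bits_def)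
  qed simp
  then show "card {r \<in> bits (2 * n). drop n r = v} \<le> 2 ^ n" by (simp add: card_bits)
qed

context good_keyed_sched
begin

section \<open>The real and the ideal world as sample spaces, and their weights\<close>

fun cip_real :: "bool list \<times> (bool list \<Rightarrow> bool list) \<Rightarrow> bool list \<Rightarrow> bool list \<Rightarrow> bool list" where
  "cip_real (k, P) d = KAFw n S P (xorb k d)"

fun prm_ideal :: "bool list \<times> (bool list \<Rightarrow> bool list) \<times> (bool list \<Rightarrow> bool list \<Rightarrow> bool list)
    \<Rightarrow> bool list \<Rightarrow> bool list" where
  "prm_ideal (k, P, E) = P"

fun cip_ideal :: "bool list \<times> (bool list \<Rightarrow> bool list) \<times> (bool list \<Rightarrow> bool list \<Rightarrow> bool list)
    \<Rightarrow> bool list \<Rightarrow> bool list \<Rightarrow> bool list" where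
  "cip_ideal (k, P, E) d = E (xorb k d)"

sublocale R: oracle_world n "bits n \<times> perms n" snd cip_real
proof
  show "finite (bits n \<times> perms n)" by simp
qed (auto simp: perms_def bij_betw_KAFw)

sublocale I: oracle_world n "bits n \<times> perms n \<times> blockciphers n" prm_ideal cip_ideal
proof
  show "finite (bits n \<times> perms n \<times> blockciphers n)" by simp
qed (auto simp: perms_def blockciphers_def permutes_imp_bij)

lemma R_ans: "R.ans (k, P) = answer n P (KAFw n S P) k"
proof -
  have "cip_real (k, P) = (\<lambda>d. KAFw n S P (xorb k d))" by (rule ext) simp
  then show ?thesis unfolding R.ans_def by (simp add: answer_shift)
qed

lemma I_ans: "I.ans (k, P, E) = answer n P E k"
proof -
  have "cip_ideal (k, P, E) = (\<lambda>d. E (xorb k d))" by (rule ext) simp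
  then show ?thesis unfolding I.ans_def by (simp add: answer_shift)
qed

lemma R_val_empty: "R.val b D {} {} = pmf (real_world n S D) b"
proof -
  have "R.val b D {} {} = (\<Sum>(k, P)\<in>bits n \<times> perms n. pmf (run (answer n P (KAFw n S P) k) D) b)
      / (card (bits n) * card (perms n))"
    unfolding R.val_def R.cons_def
    by (intro arg_cong2[where f = "(/)"] sum.cong) (auto simp: R_ans card_cartesian_product)
  also have "\<dots> = pmf (real_world n S D) b"
    by (simp add: real_world_def pmf_bind integral_pmf_of_set perms_nonempty
      sum.cartesian_product[symmetric] sum_divide_distrib mult.commute)
  finally show ?thesis .
qed

lemma I_val_empty: "I.val b D {} {} = pmf (ideal_world n D) b"
proof -
  have "I.val b D {} {} = (\<Sum>(k, P, E)\<in>bits n \<times> perms n \<times> blockciphers n. pmf (run (answer n P E k) D) b)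
      / (card (bits n) * (card (perms n) * card (blockciphers n)))"
    unfolding I.val_def I.cons_def
    by (intro arg_cong2[where f = "(/)"] sum.cong) (auto simp: I_ans card_cartesian_product)
  also have "\<dots> = pmf (ideal_world n D) b"
    by (simp add: ideal_world_def pmf_bind integral_pmf_of_set perms_nonempty blockciphers_nonempty
      sum.cartesian_product[symmetric] sum_divide_distrib mult_ac)
  finally show ?thesis .
qed

lemma R_cons: "R.cons Q U = (SIGMA k:bits n. {P \<in> Ext n Q. \<forall>(d, w, s)\<in>U. KAFw n S P (xorb k d) w = s})"
  unfolding R.cons_def by (auto simp: perms_def Ext_def)

lemma R_wt: "R.wt Q U = (\<Sum>k\<in>bits n. real (card {P \<in> Ext n Q. \<forall>(d, w, s)\<in>U. KAFw n S P (xorb k d) w = s}))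
    / (2 ^ n * card (perms n))"
  unfolding R.wt_def R_cons by (simp add: card_cartesian_product card_bits)

lemma I_cons: "I.cons Q U = (SIGMA k:bits n. Ext n Q \<times> ExtIC n k U)"
  unfolding I.cons_def by (auto simp: perms_def Ext_def ExtIC_def)

lemma I_wt: "I.wt Q U = (\<Sum>k\<in>bits n. real (card (Ext n Q)) * real (card (ExtIC n k U)))
    / (2 ^ n * card (perms n) * card (blockciphers n))"
  unfolding I.wt_def I_cons by (simp add: card_cartesian_product card_bits)

lemma card_worlds_pos: "0 < card (perms n)" "0 < card (blockciphers n)"
  by (simp_all add: card_gt_0_iff perms_nonempty blockciphers_nonempty)

lemma I_wt_fresh:
  assumes U: "valid_E n U" and t: "d \<in> bits n" "w \<in> bits (2 * n)" "s \<in> bits (2 * n)" "(d, w, s) \<notin> U"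
  shows "(2 ^ (2 * n) - real (card U)) * I.wt Q (insert (d, w, s) U) \<le> I.wt Q U"
proof -
  have nat_diff: "real a - real b \<le> real (a - b)" for a b by simp
  have "(2 ^ (2 * n) - real (card U)) * real (card (ExtIC n k (insert (d, w, s) U))) \<le> real (card (ExtIC n k U))"
    if "k \<in> bits n" for k
  proof -
    have "(2 ^ (2 * n) - real (card U)) \<le> real (2 ^ (2 * n) - card U)"
      using nat_diff[of "2 ^ (2 * n)" "card U"] by simp
    then have "(2 ^ (2 * n) - real (card U)) * real (card (ExtIC n k (insert (d, w, s) U))) \<le>
      real ((2 ^ (2 * n) - card U) * card (ExtIC n k (insert (d, w, s) U)))"
      unfolding of_nat_mult by (rule mult_right_mono) simp
    also have "\<dots> \<le> real (card (ExtIC n k U))"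
      unfolding of_nat_le_iff by (rule ExtIC_fresh[OF that U t])
    finally show ?thesis .
  qed
  then have "(\<Sum>k\<in>bits n. real (card (Ext n Q)) * ((2 ^ (2 * n) - real (card U)) * real (card (ExtIC n k (insert (d, w, s) U)))))
    \<le> (\<Sum>k\<in>bits n. real (card (Ext n Q)) * real (card (ExtIC n k U)))"
    by (intro sum_mono mult_left_mono) auto
  then have "(2 ^ (2 * n) - real (card U)) * (\<Sum>k\<in>bits n. real (card (Ext n Q)) * real (card (ExtIC n k (insert (d, w, s) U))))
    \<le> (\<Sum>k\<in>bits n. real (card (Ext n Q)) * real (card (ExtIC n k U)))"
    by (simp add: sum_distrib_left mult_ac)
  then show ?thesis unfolding I_wt by (simp add: divide_right_mono)
qed

text \<open>A forward answer can collide with an earlier triple only if its left half takes one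
  determined value; for an inverse answer it is the right half. This leaves at most
  \<open>card U * 2 ^ n\<close> answers, each keeping at most the fraction 2/N^2 of the
  weight.\<close>

lemma collision_bound:
  assumes U: "valid_E n U" and nc: "\<not> coll U" and small: "card U < qe" "4 * qe \<le> 2 ^ n"
    and q: "well_formed n q" "\<not> is_Pquery q"
  shows "(\<Sum>r | r \<in> responses n q \<and> coll (record_E q r U). I.wt Q (record_E q r U)) \<le> 2 * qe / 2 ^ n * I.wt Q U"
proof -
  let ?C = "{r \<in> responses n q. coll (record_E q r U)}" and ?z = "zeros n"
  have finU: "finite U" using U by (simp add: valid_E_def)
  have new: "\<exists>t'\<in>U. \<forall>b. hX ?z (t, b) = hX ?z (t', b)" if "coll (insert t U)" for t
    using that nc unfolding coll_def by (metis insert_iff)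
  have count: "card ?C \<le> card U * 2 ^ n"
  proof -
    obtain F where F: "?C \<subseteq> (\<Union>t'\<in>U. F t')" "\<And>t'. finite (F t')" "\<And>t'. card (F t') \<le> 2 ^ n"
    proof (cases q)
      case (EFwd d w)
      let ?F = "\<lambda>t'. {r \<in> bits (2 * n). take n r = xorb (\<phi> True (xorb ?z d)) (hX ?z (t', True))}"
      have "?C \<subseteq> (\<Union>t'\<in>U. ?F t')"
      proof
        fix r assume r: "r \<in> ?C"
        then have rb: "r \<in> bits (2 * n)" using EFwd by (simp add: responses_def)
        obtain t' where t': "t' \<in> U" "hX ?z ((d, w, r), True) = hX ?z (t', True)"
          using r new[of "(d, w, r)"] EFwd by (auto simp: record_E_def simp del: hX.simps)
        have "take n r \<in> bits n" using rb by (auto simp: bits_def)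
        moreover have "xorb (\<phi> True (xorb ?z d)) (take n r) = hX ?z (t', True)"
          using t'(2) unfolding hX_\<phi> by simp
        ultimately have "take n r = xorb (\<phi> True (xorb ?z d)) (hX ?z (t', True))"
          using xorb_solve \<phi>_bits by blast
        then show "r \<in> (\<Union>t'\<in>U. ?F t')" using rb t' by blast
      qed
      then show ?thesis by (rule that) (simp_all add: card_half_fixed)
    next
      case (EInv d s)
      let ?F = "\<lambda>t'. {r \<in> bits (2 * n). drop n r = xorb (\<phi> False (xorb ?z d)) (hX ?z (t', False))}"
      have "?C \<subseteq> (\<Union>t'\<in>U. ?F t')"
      proof
        fix r assume r: "r \<in> ?C"
        then have rb: "r \<in> bits (2 * n)" using EInv by (simp add: responses_def)
        obtain t' where t': "t' \<in> U" "hX ?z ((d, r, s), False) = hX ?z (t', False)"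
          using r new[of "(d, r, s)"] EInv by (auto simp: record_E_def simp del: hX.simps)
        have "drop n r \<in> bits n" using rb by (auto simp: bits_def)
        moreover have "xorb (\<phi> False (xorb ?z d)) (drop n r) = hX ?z (t', False)"
          using t'(2) unfolding hX_\<phi> by simp
        ultimately have "drop n r = xorb (\<phi> False (xorb ?z d)) (hX ?z (t', False))"
          using xorb_solve \<phi>_bits by blast
        then show "r \<in> (\<Union>t'\<in>U. ?F t')" using rb t' by blast
      qed
      then show ?thesis by (rule that) (simp_all add: card_half_fixed)
    qed (use q in auto)
    have "card ?C \<le> card (\<Union>t'\<in>U. F t')" using F finU by (intro card_mono) auto
    also have "\<dots> \<le> (\<Sum>t'\<in>U. card (F t'))" using finU by (rule card_UN_le)
    also have "\<dots> \<le> (\<Sum>t'\<in>U. 2 ^ n)" using F by (intro sum_mono) auto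
    finally show ?thesis by simp
  qed
  let ?M = "2 ^ (2 * n) - real (card U)"
  have "real (card U) \<le> real (2 ^ n) / 4"
  proof -
    have "real (4 * qe) \<le> real (2 ^ n)" using small(2) by (simp only: of_nat_le_iff)
    then show ?thesis using small(1) by simp
  qed
  moreover have "real (2 ^ n) \<le> 2 ^ (2 * n)" "0 < real (2 ^ n)" by simp_all
  ultimately have M: "2 ^ (2 * n) / 2 \<le> ?M" by linarith
  then have Mpos: "0 < ?M" by (smt (verit) half_gt_zero zero_less_power)
  have "I.wt Q (record_E q r U) \<le> I.wt Q U / ?M" if r: "r \<in> ?C" for r
  proof -
    obtain t where t: "record_E q r U = insert t U" "t \<in> bits n \<times> bits (2 * n) \<times> bits (2 * n)"
      using q r by (cases q) (auto simp: record_E_def responses_def well_formed_def)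
    \<comment> \<open>An answer that merely repeats a recorded triple leaves \<open>U\<close>
      unchanged, hence free of collisions.\<close>
    have "t \<notin> U" using r nc t by (auto simp: insert_absorb)
    then have "?M * I.wt Q (insert t U) \<le> I.wt Q U"
      using I_wt_fresh[OF U, of "fst t" "fst (snd t)" "snd (snd t)" Q] t(2) by auto
    then show ?thesis using Mpos t(1) by (simp add: field_simps)
  qed
  then have "(\<Sum>r\<in>?C. I.wt Q (record_E q r U)) \<le> (\<Sum>r\<in>?C. I.wt Q U / ?M)" by (rule sum_mono)
  also have "\<dots> = real (card ?C) * (I.wt Q U / ?M)" by simp
  also have "\<dots> \<le> real (qe * 2 ^ n) * (I.wt Q U / (2 ^ (2 * n) / 2))"
  proof (rule mult_mono)
    show "real (card ?C) \<le> real (qe * 2 ^ n)"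
      unfolding of_nat_le_iff by (rule order_trans[OF count]) (use small in simp)
    show "I.wt Q U / ?M \<le> I.wt Q U / (2 ^ (2 * n) / 2)"
      using M Mpos by (intro divide_left_mono mult_pos_pos) auto
  qed (use Mpos in auto)
  also have "\<dots> = 2 * qe / 2 ^ n * I.wt Q U"
    by (simp add: power_mult power2_eq_square field_simps power_even_eq)
  finally show ?thesis by simp
qed

text \<open>The pivot is x = \<open>card (Ext n Q)\<close>, with weights scaled by
  \<open>card (perms n)\<close>. The real weight is at least (1 - \<delta>)(1 - a) x / N^(2u):
  \<open>\<delta>\<close> pays for bad keys and \<open>a\<close> for the exposures under a good key.
  The ideal weight is at most x / (N^2 - u)^u.\<close>

lemma weight_ratio:
  assumes Q: "valid_P n Q" and U: "valid_E n U" and card: "card Q \<le> qf" "card U \<le> qe"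
    and nc: "\<not> coll U" and pos: "0 < I.wt Q U"
    and small: "0 < qe \<Longrightarrow> 4 * (qf + 2 * qe + 1) \<le> 2 ^ n"
  shows "(1 - (10 * real qe * qf + 50 * (real qe)\<^sup>2 + 3 * real qe) / 2 ^ n) * I.wt Q U \<le> R.wt Q U"
proof -
  define N u q where "N = (2 :: real) ^ n" and "u = real (card U)" and "q = real (card Q)"
  define a \<delta> where "a = (8 * u * q + 48 * u\<^sup>2 + 8 / 3 * u) / N" and "\<delta> = (2 * u * q + u\<^sup>2) / N"
  define e where "e = (10 * real qe * qf + 50 * (real qe)\<^sup>2 + 3 * real qe) / N"
  have N: "1 \<le> N" by (simp add: N_def)
  have u: "0 \<le> u" "u \<le> qe" and q: "0 \<le> q" "q \<le> qf" using card by (simp_all add: u_def q_def)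
  have uq: "u * q \<le> real qe * qf" "u\<^sup>2 \<le> (real qe)\<^sup>2"
    using u q by (auto intro: mult_mono power_mono)
  \<comment> \<open>The constants come from 8 + 2 = 10 and 48 + 1 + 1 = 50, with 8/3 rounded up to
    3.\<close>
  have "(8 * u * q + 48 * u\<^sup>2 + 8 / 3 * u) + (2 * u * q + u\<^sup>2) + u\<^sup>2
      \<le> 10 * real qe * qf + 50 * (real qe)\<^sup>2 + 3 * real qe"
    using uq u mult.assoc[of 10 "real qe" "real qf"] mult.assoc[of 8 u q] mult.assoc[of 2 u q] by linarith
  then have "((8 * u * q + 48 * u\<^sup>2 + 8 / 3 * u) + (2 * u * q + u\<^sup>2) + u\<^sup>2) / N \<le> e"
    unfolding e_def using N by (intro divide_right_mono) auto
  then have split: "a + \<delta> + u\<^sup>2 / N \<le> e" by (simp add: a_def \<delta>_def add_divide_distrib)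
  have nn: "0 \<le> a" "0 \<le> \<delta>" "0 \<le> u\<^sup>2 / N" using u q N by (simp_all add: a_def \<delta>_def)
  have "(1 - e) * I.wt Q U \<le> R.wt Q U"
  proof (cases "e \<le> 1")
    case False
    then have "(1 - e) * I.wt Q U \<le> 0" by (intro mult_nonpos_nonneg) auto
    then show ?thesis using R.wt_nonneg[of Q U] by linarith
  next
    case True
    have le1: "a \<le> 1" "\<delta> \<le> 1" "u\<^sup>2 / N \<le> 1" using split nn True by linarith+
    let ?K = "\<lambda>k. {P \<in> Ext n Q. \<forall>(d, w, s)\<in>U. KAFw n S P (xorb k d) w = s}"
    let ?x = "real (card (Ext n Q))" and ?p = "real (card (perms n))" and ?B = "real (card (blockciphers n))"
    have pB: "0 < ?p" "0 < ?B" using card_worlds_pos by simp_all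
    \<comment> \<open>Positive ideal weight provides a blockcipher that fits the transcript, so for
      each offset \<open>U\<close> is functional and injective.\<close>
    have "I.cons Q U \<noteq> {}"
      using pos by (auto simp: I.wt_def)
    then obtain k\<^sub>0 E where E: "k\<^sub>0 \<in> bits n" "E \<in> ExtIC n k\<^sub>0 U" unfolding I_cons by auto
    have Eeq: "E (xorb k\<^sub>0 d) w = s" if "(d, w, s) \<in> U" for d w s using E that by (auto simp: ExtIC_def)
    have fn: "s = s'" if "(d, w, s) \<in> U" "(d, w, s') \<in> U" for d w s s'
      using Eeq[OF that(1)] Eeq[OF that(2)] by simp
    have inj: "w = w'" if "(d, w, s) \<in> U" "(d, w', s) \<in> U" for d w w' s
    proof (rule injD)
      show "inj (E (xorb k\<^sub>0 d))"
        using permutes_inj[OF ExtIC_permutes[OF E(2,1)]] valid_E_D(1)[OF U that(1)] by blast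
      show "E (xorb k\<^sub>0 d) w = E (xorb k\<^sub>0 d) w'" using Eeq[OF that(1)] Eeq[OF that(2)] by simp
    qed
    have sm: "4 * (card Q + 2 * card U + 1) \<le> 2 ^ n" if "U \<noteq> {}"
    proof -
      have "0 < qe" using that U card(2) by (auto simp: valid_E_def intro: Nat.gr0I)
      then show ?thesis by (intro order_trans[OF _ small]) (use card in auto)
    qed
    have K: "(1 - a) * ?x \<le> N ^ (2 * card U) * real (card (?K k))" if "k \<in> bits n" "\<not> bad_key Q U k" for k
      using KAFw_count[OF Q U that(1) fn inj nc that(2) sm]
      by (simp add: a_def N_def u_def q_def)
    have good: "(1 - \<delta>) * N \<le> card {k \<in> bits n. \<not> bad_key Q U k}"
      using rare_complement[OF rare_bad_key[OF Q U], of "\<lambda>k. \<not> bad_key Q U k"]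
      by (simp add: \<delta>_def N_def u_def q_def card_bits)
    have "((1 - \<delta>) * N) * ((1 - a) * ?x) \<le> real (card {k \<in> bits n. \<not> bad_key Q U k}) * ((1 - a) * ?x)"
      using good le1 by (intro mult_right_mono) auto
    also have "\<dots> = (\<Sum>k | k \<in> bits n \<and> \<not> bad_key Q U k. (1 - a) * ?x)" by simp
    also have "\<dots> \<le> (\<Sum>k | k \<in> bits n \<and> \<not> bad_key Q U k. N ^ (2 * card U) * real (card (?K k)))"
      by (intro sum_mono K) auto
    also have "\<dots> \<le> (\<Sum>k\<in>bits n. N ^ (2 * card U) * real (card (?K k)))"
      using N by (intro sum_mono2) auto
    also have "\<dots> = N ^ (2 * card U) * (R.wt Q U * (N * ?p))"
      using pB N by (simp add: R_wt sum_distrib_left N_def perms_nonempty)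
    finally have lower: "(1 - \<delta>) * (1 - a) * ?x \<le> N ^ (2 * card U) * (R.wt Q U * ?p)"
      using N by (simp add: mult_ac)
    let ?M = "N\<^sup>2 - u"
    have M2: "real (2 ^ (2 * n)) = N\<^sup>2" by (simp add: N_def power_mult[symmetric] mult.commute)
    have uN: "u \<le> N\<^sup>2" "card U \<le> 2 ^ (2 * n)"
    proof -
      have "4 * card U \<le> 2 ^ n"
        by (cases "U = {}") (use order_trans[OF _ sm, of "4 * card U"] in auto)
      then have "real (4 * card U) \<le> real (2 ^ n)" by (simp only: of_nat_le_iff)
      then have "4 * u \<le> N" by (simp add: u_def N_def)
      then have "u \<le> N" using u by linarith
      also have "N \<le> N\<^sup>2" using N by (simp add: power2_eq_square)
      finally show "u \<le> N\<^sup>2" .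
      then have "real (card U) \<le> real (2 ^ (2 * n))" unfolding M2 u_def .
      then show "card U \<le> 2 ^ (2 * n)" by (simp only: of_nat_le_iff)
    qed
    have "I.wt Q U * (N * ?p * ?B) = (\<Sum>k\<in>bits n. ?x * real (card (ExtIC n k U)))"
      by (simp add: I_wt N_def perms_nonempty blockciphers_nonempty)
    then have "?M ^ card U * (I.wt Q U * (N * ?p * ?B)) = (\<Sum>k\<in>bits n. ?x * (?M ^ card U * real (card (ExtIC n k U))))"
      by (simp only: sum_distrib_left mult_ac)
    also have "\<dots> \<le> (\<Sum>k\<in>bits n. ?x * ?B)"
    proof (intro sum_mono mult_left_mono)
      fix k assume k: "k \<in> bits n"
      have "real ((2 ^ (2 * n) - card U) ^ card U * card (ExtIC n k U)) \<le> ?B"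
        unfolding of_nat_le_iff by (rule ExtIC_upper[OF k U order_refl])
      moreover have "real (2 ^ (2 * n) - card U) = ?M"
        unfolding of_nat_diff[OF uN(2)] M2 u_def ..
      ultimately show "?M ^ card U * real (card (ExtIC n k U)) \<le> ?B" by simp
    qed simp
    also have "\<dots> = N * (?x * ?B)" by (simp add: card_bits N_def)
    finally have "(N * ?B) * (?M ^ card U * (I.wt Q U * ?p)) \<le> (N * ?B) * ?x" by (simp add: mult_ac)
    then have upper: "?M ^ card U * (I.wt Q U * ?p) \<le> ?x" using pB N by simp
    \<comment> \<open>The loss from drawing cipher outputs without replacement; u^2/N^2 is weakened
      to u^2/N to join the other error terms.\<close>
    have bern: "1 - u\<^sup>2 / N \<le> (1 - u / N\<^sup>2) ^ card U"
    proof -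
      have "u\<^sup>2 / N\<^sup>2 \<le> u\<^sup>2 / N" using N by (intro divide_left_mono) (auto simp: power2_eq_square)
      moreover have "1 + real (card U) * (- (u / N\<^sup>2)) \<le> (1 + - (u / N\<^sup>2)) ^ card U"
        using uN N by (intro Bernoulli_inequality) (simp add: field_simps)
      ultimately show ?thesis by (simp add: u_def power2_eq_square)
    qed
    have Mpow: "?M ^ card U = N ^ (2 * card U) * (1 - u / N\<^sup>2) ^ card U"
      using N by (simp add: power_mult power_mult_distrib[symmetric] right_diff_distrib)
    have "1 - e \<le> 1 - (a + \<delta> + u\<^sup>2 / N)" using split by simp
    also have "\<dots> \<le> (1 - \<delta>) * (1 - a) * (1 - u\<^sup>2 / N)"
    proof -
      have sub: "1 - (x + y) \<le> (1 - x) * (1 - y)" if "0 \<le> x" "0 \<le> y" for x y :: real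
        using mult_nonneg_nonneg[OF that] by (simp add: algebra_simps)
      have "1 - (\<delta> + a) \<le> (1 - \<delta>) * (1 - a)" using nn by (intro sub)
      then have "(1 - (\<delta> + a)) * (1 - u\<^sup>2 / N) \<le> (1 - \<delta>) * (1 - a) * (1 - u\<^sup>2 / N)"
        using le1 by (intro mult_right_mono) auto
      moreover have "1 - (a + \<delta> + u\<^sup>2 / N) \<le> (1 - (\<delta> + a)) * (1 - u\<^sup>2 / N)"
        using sub[of "\<delta> + a" "u\<^sup>2 / N"] nn by (simp add: add.commute)
      ultimately show ?thesis by linarith
    qed
    also have "\<dots> \<le> (1 - \<delta>) * (1 - a) * (1 - u / N\<^sup>2) ^ card U"
      using bern le1 by (intro mult_left_mono) auto
    finally have main: "1 - e \<le> (1 - \<delta>) * (1 - a) * (1 - u / N\<^sup>2) ^ card U" .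
    let ?f = "(1 - u / N\<^sup>2) ^ card U"
    have "(1 - e) * (N ^ (2 * card U) * (I.wt Q U * ?p)) \<le>
      (1 - \<delta>) * (1 - a) * ?f * (N ^ (2 * card U) * (I.wt Q U * ?p))"
      using main N by (intro mult_right_mono) auto
    also have "\<dots> = (1 - \<delta>) * (1 - a) * (?M ^ card U * (I.wt Q U * ?p))" by (simp add: Mpow)
    also have "\<dots> \<le> (1 - \<delta>) * (1 - a) * ?x" using upper le1 by (intro mult_left_mono) auto
    also have "\<dots> \<le> N ^ (2 * card U) * (R.wt Q U * ?p)" by (rule lower)
    finally have "(N ^ (2 * card U) * ?p) * ((1 - e) * I.wt Q U) \<le> (N ^ (2 * card U) * ?p) * R.wt Q U"
      by (simp add: mult_ac)
    moreover have "0 < N ^ (2 * card U) * ?p" using N pB by simp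
    ultimately show ?thesis by (simp only: mult_le_cancel_left_pos)
  qed
  then show ?thesis by (simp add: e_def N_def)
qed

text \<open>Each of the \<open>qe\<close> cipher queries adds a collision charge of 2 qe/N, which
  raises 50 to 52. The size condition is restricted to positive \<open>qe\<close> because for
  \<open>qe = 0\<close> the bound is 0, however many P-queries are made.\<close>

lemma advantage_bound:
  assumes small: "0 < qe \<Longrightarrow> 4 * (qf + 2 * qe + 1) \<le> 2 ^ n" and D: "query_bounded D qf qe"
  shows "rka_adv n S D \<le> (10 * real qe * qf + 52 * (real qe)\<^sup>2 + 3 * real qe) / 2 ^ n"
proof -
  let ?\<epsilon> = "(10 * real qe * qf + 50 * (real qe)\<^sup>2 + 3 * real qe) / 2 ^ n" and ?\<kappa> = "2 * real qe / 2 ^ n"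
  interpret W: two_worlds n "bits n \<times> perms n" snd cip_real "bits n \<times> perms n \<times> blockciphers n"
    prm_ideal cip_ideal coll ?\<epsilon> ?\<kappa> qf qe
  proof unfold_locales
    show "0 \<le> ?\<epsilon>" "0 \<le> ?\<kappa>" by simp_all
    fix Q U
    assume Q: "valid_P n Q" and U: "valid_E n U" and nc: "\<not> coll U"
    show "(1 - ?\<epsilon>) * I.wt Q U \<le> R.wt Q U" if "card Q \<le> qf" "card U \<le> qe" "0 < I.wt Q U"
      by (rule weight_ratio[OF Q U that(1,2) nc that(3) small])
    fix q assume q: "card U < qe" "well_formed n q" "\<not> is_Pquery q"
    have "4 * qe \<le> 2 ^ n" by (rule order_trans[OF _ small]) (use q in auto)
    then show "(\<Sum>r | r \<in> responses n q \<and> coll (record_E q r U). I.wt Q (record_E q r U)) \<le> ?\<kappa> * I.wt Q U"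
      by (rule collision_bound[OF U nc q(1) _ q(2,3)])
  qed
  have "I.wt {} {} = 1"
    using card_worlds_pos by (simp add: I.wt_def I.cons_def card_cartesian_product card_gt_0_iff)
  then have diff: "pmf (ideal_world n D) b - pmf (real_world n S D) b \<le> ?\<epsilon> + ?\<kappa> * qe" for b
    using W.val_difference[OF D, of "{}" "{}" b]
    by (simp add: R_val_empty I_val_empty valid_P_def valid_E_def coll_def)
  have bool: "pmf p False = 1 - pmf p True" for p :: "bool pmf"
    using sum_pmf_eq_1[of UNIV p] by (simp add: UNIV_bool[symmetric]) (simp add: UNIV_bool algebra_simps)
  \<comment> \<open>The one-sided bound for output False is the reverse inequality for output True,
    which yields the absolute value.\<close>
  have "rka_adv n S D \<le> ?\<epsilon> + ?\<kappa> * qe"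
    using diff[of True] diff[of False] unfolding rka_adv_def bool by linarith
  also have "\<dots> = (10 * real qe * qf + 52 * (real qe)\<^sup>2 + 3 * real qe) / 2 ^ n"
    by (simp add: power2_eq_square add_divide_distrib[symmetric])
  finally show ?thesis .
qed

end

theorem theorem5:
  fixes n qf qe :: nat and S :: sched
  assumes "1 \<le> n"
    and "affine_sched n S"
    and "good_sched n S"
    and "real qf + 4 * real qe \<le> 2 ^ n / 2"
  shows "\<forall>D. query_bounded D qf qe \<longrightarrow>
           rka_adv n S D \<le> (14 * real qe * real qf + 57 * (real qe)^2 + 4 * real qe) / 2 ^ n"
proof (intro allI impI)
  fix D assume D: "query_bounded D qf qe"
  interpret good_keyed_sched n S by unfold_locales fact+
  let ?A = "14 * real qe * real qf + 57 * (real qe)^2 + 4 * real qe"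
  show "rka_adv n S D \<le> ?A / 2 ^ n"
  \<comment> \<open>A claimed bound above 1 holds trivially. Otherwise the numerator is at most N,
    and for \<open>qe\<close> at least 1 its terms dominate \<open>4 * (qf + 2 * qe + 1)\<close>,
    which is the size condition.\<close>
  proof (cases "?A \<le> 2 ^ n")
    case True
    have "4 * (qf + 2 * qe + 1) \<le> 2 ^ n" if "0 < qe"
    proof -
      have "1 * qf \<le> qe * qf" "1 * qe \<le> qe * qe" using that by (intro mult_right_mono; simp)+
      then have "4 * (qf + 2 * qe + 1) \<le> 14 * (qe * qf) + 57 * (qe * qe) + 4 * qe"
        using that unfolding distrib_left by linarith
      then have "real (4 * (qf + 2 * qe + 1)) \<le> real (14 * (qe * qf) + 57 * (qe * qe) + 4 * qe)"
        by (simp only: of_nat_le_iff)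
      also have "\<dots> = ?A" by (simp add: power2_eq_square)
      also have "?A \<le> real (2 ^ n)" using True by simp
      finally show ?thesis by (simp only: of_nat_le_iff)
    qed
    then have "rka_adv n S D \<le> (10 * real qe * qf + 52 * (real qe)\<^sup>2 + 3 * real qe) / 2 ^ n"
      using D by (rule advantage_bound)
    also have "\<dots> \<le> ?A / 2 ^ n" by (intro divide_right_mono) auto
    finally show ?thesis .
  next
    case False
    have "rka_adv n S D \<le> 1"
      using pmf_le_1[of "real_world n S D" True] pmf_le_1[of "ideal_world n D" True]
        pmf_nonneg[of "real_world n S D" True] pmf_nonneg[of "ideal_world n D" True]
      unfolding rka_adv_def by linarith
    also have "1 \<le> ?A / 2 ^ n" using False by simp
    finally show ?thesis .
  qed
qed

end
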